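(* For every $\varepsilon, \alpha > 0$, there exists $\beta > 0$ such that the following holds for all sufficiently large $n$ and all $k < (1/2-\alpha)n$. If $\mathbf{L} \in \mathcal{L}_{k,n}$ is a uniformly random $k\times n$ Latin rectangle and $m \le \beta n$, then $$\binom{n}{m}^2\binom{k}{m}|\mathcal{L}_{m}|\left(\frac{1-\varepsilon}{n}\right)^{m^2} \le \mathbb{E}\left[SS_m(\mathbf{L})\right] \le \binom{n}{m}^2\binom{k}{m}|\mathcal{L}_{m}|\left(\frac{1+\varepsilon}{n}\right)^{m^2}.$$
   Context: Here $n$, $k$, $m$ are positive integers and $[n] = \{1,\dots,n\}$. $\mathcal{L}_m$ is the set of order-$m$ Latin squares with symbol set $[m]$ ($m\times m$ arrays in which each row and each column contains each symbol exactly once). For $k\le n$, a $k\times n$ Latin rectangle is a $k\times n$ array of $n$ symbols in which each row contains each symbol exactly once and each column contains each symbol at most once; $\mathcal{L}_{k,n}$ is the set of those with symbol set $[n]$. For $m<n$, an order-$m$ subsquare is an $m\times m$ array induced by choosing a set of $m$ rows and a set of $m$ columns (not necessarily consecutive); it is Latin if it is itself a Latin square on some set of $m$ symbols. $SS_m(L)$ denotes the number of order-$m$ Latin subsquares of $L$.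
   Formalization: The lower bound is stated only for ε < 2, because for ε > 2 it fails (e.g. ε = 3, k = m = 2, α < 1/2: the bound tends to 8 while the expectation tends to 1/2); the upper bound is stated for every ε > 0. *)

theory Defs
  imports "HOL-Probability.Probability_Mass_Function"
begin

(* bij_betw says that every symbol of S occurs exactly once in each row and each column, and
   that no other symbol occurs. *)
definition latin_square_on :: "nat set \<Rightarrow> nat set \<Rightarrow> nat set \<Rightarrow> (nat \<Rightarrow> nat \<Rightarrow> nat) \<Rightarrow> bool" where
  "latin_square_on R C S L \<longleftrightarrow>
     (\<forall>i\<in>R. bij_betw (L i) C S) \<and> (\<forall>j\<in>C. bij_betw (\<lambda>i. L i j) R S)"

(* Arrays are extensional (undefined outside the index ranges), so that different functions are
   different arrays; counting and uniform sampling below rely on this. *)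
definition latin_squares :: "nat \<Rightarrow> (nat \<Rightarrow> nat \<Rightarrow> nat) set" where
  "latin_squares m =
     {L \<in> {1..m} \<rightarrow>\<^sub>E {1..m} \<rightarrow>\<^sub>E {1..m}. latin_square_on {1..m} {1..m} {1..m} L}"

definition latin_rectangles :: "nat \<Rightarrow> nat \<Rightarrow> (nat \<Rightarrow> nat \<Rightarrow> nat) set" where
  "latin_rectangles k n =
     {L \<in> {1..k} \<rightarrow>\<^sub>E {1..n} \<rightarrow>\<^sub>E {1..n}.
        (\<forall>i\<in>{1..k}. bij_betw (L i) {1..n} {1..n}) \<and>
        (\<forall>j\<in>{1..n}. inj_on (\<lambda>i. L i j) {1..k})}"

(* A subsquare is identified with its pair (R, C) of row set and column set. *)
definition latin_subsquares ::
    "nat \<Rightarrow> nat \<Rightarrow> nat \<Rightarrow> (nat \<Rightarrow> nat \<Rightarrow> nat) \<Rightarrow> (nat set \<times> nat set) set" where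
  "latin_subsquares k n m L =
     {(R, C). R \<subseteq> {1..k} \<and> C \<subseteq> {1..n} \<and> card R = m \<and> card C = m \<and>
        (\<exists>S. card S = m \<and> latin_square_on R C S L)}"

definition SS :: "nat \<Rightarrow> nat \<Rightarrow> nat \<Rightarrow> (nat \<Rightarrow> nat \<Rightarrow> nat) \<Rightarrow> nat" where
  "SS k n m L = card (latin_subsquares k n m L)"

end

theory Submission
  imports Defs
begin

text \<open>
  Fix rows, columns and symbols and a Latin square \<open>F\<close> on them. It suffices that a random
  rectangle agrees with \<open>F\<close> on these \<open>m\<^sup>2\<close> cells with probability
  \<open>((1 \<plusminus> \<epsilon>) / n) ^ m\<^sup>2\<close>: summing over all choices gives the expectation
  (\<open>expectation_SS_bounds\<close>). By the chain rule it suffices to prescribe one cell \<open>(i, j)\<close> at a time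
  and to show that, given any set of cells already prescribed, \<open>L i j = s\<close> has probability
  \<open>(1 \<plusminus> \<epsilon>) / n\<close>, where \<open>s = F i j\<close> (\<open>card_completions_insert\<close>).

  The randomness comes from resampling one row. Given the other rows, row \<open>i\<close> is a uniformly random
  perfect matching of columns with symbols in a bipartite graph whose degrees are all close to
  \<open>n - k\<close>, which exceeds half of \<open>n\<close> by a fixed proportion. In such a graph all edges are almost
  equally likely (\<open>uniform_edgesI\<close>), so \<open>L i j = s\<close> holds with probability about
  \<open>1 / (n - k)\<close> whenever \<open>s\<close> does not occur in the rest of column \<open>j\<close>.

  What remains is the probability that \<open>s\<close> does not occur in column \<open>j\<close>, say \<open>z\<close>. This need not be
  estimated by other means: apply the resampling to every row. Each row then has \<open>s\<close> in column \<open>j\<close>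
  with probability about \<open>z / (n - k)\<close>, up to the few rows touched by the pattern, and since
  these disjoint events exhaust the space, \<open>z * (1 + k / (n - k))\<close> is about 1. So \<open>z\<close> is
  about \<open>(n - k) / n\<close>, and \<open>L i j = s\<close> has probability about \<open>1 / n\<close>
  (\<open>self_consistent_estimate\<close>).

  The statement on matchings is proved by a contraction. Let \<open>u j\<close> be the number of perfect matchings
  after deleting \<open>j\<close>, where \<open>j\<close> ranges over the side that has one vertex more. Expanding \<open>u j\<close> at \<open>j'\<close>
  and \<open>u j'\<close> at \<open>j\<close> gives the sums, over the neighbourhoods of \<open>j'\<close> and of \<open>j\<close>, of one and the same
  function, which is of the same kind as \<open>u\<close> for a smaller graph. As the degrees exceed half
  of \<open>n\<close>, the two neighbourhoods overlap, and the relative deviation of \<open>u\<close> from being constant is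
  smaller than that of the function summed by a constant factor (\<open>sum_contraction\<close>). Boundedly many
  rounds turn a crude bound into one within \<open>\<eta>\<close> of 1 (\<open>num_matchings_delete_ratio\<close>).
\<close>

section \<open>Counting perfect matchings\<close>

text \<open>
  A matching is encoded as an extensional bijection from one side to the other, because the rows of
  a Latin rectangle have this form.
\<close>

definition matchings :: "('a \<Rightarrow> 'b \<Rightarrow> bool) \<Rightarrow> 'a set \<Rightarrow> 'b set \<Rightarrow> ('a \<Rightarrow> 'b) set" where
  "matchings E J S = {f \<in> J \<rightarrow>\<^sub>E S. bij_betw f J S \<and> (\<forall>j\<in>J. E j (f j))}"

definition num_matchings :: "('a \<Rightarrow> 'b \<Rightarrow> bool) \<Rightarrow> 'a set \<Rightarrow> 'b set \<Rightarrow> nat" where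
  "num_matchings E J S = card (matchings E J S)"

lemma finite_matchings: "finite J \<Longrightarrow> finite S \<Longrightarrow> finite (matchings E J S)"
  unfolding matchings_def by (simp add: finite_PiE)

lemma bij_betw_matchings_through:
  assumes j: "j \<in> J" and s: "s \<in> S" and E: "E j s"
  shows "bij_betw (\<lambda>f. f(j := s)) (matchings E (J - {j}) (S - {s})) {f \<in> matchings E J S. f j = s}"
proof (rule bij_betwI[where g = "\<lambda>f. f(j := undefined)"])
  have ins: "insert j (J - {j}) = J" "insert s (S - {s}) = S" using j s by auto
  show "(\<lambda>f. f(j := s)) \<in> matchings E (J - {j}) (S - {s}) \<rightarrow> {f \<in> matchings E J S. f j = s}"
  proof
    fix f assume f: "f \<in> matchings E (J - {j}) (S - {s})"
    have "bij_betw (f(j := s)) (insert j (J - {j})) (insert s (S - {s}))"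
    proof (rule bij_betw_combine[where A = "{j}" and B = "{s}", simplified])
      show "bij_betw (f(j := s)) (J - {j}) (S - {s})"
        using f by (subst bij_betw_cong[where g = f]) (auto simp: matchings_def)
    qed (auto simp: bij_betw_def)
    then have "bij_betw (f(j := s)) J S" by (simp only: ins)
    then show "f(j := s) \<in> {f \<in> matchings E J S. f j = s}"
      using f j s E by (auto simp: matchings_def PiE_def extensional_def Pi_def)
  qed
  show "(\<lambda>f. f(j := undefined)) \<in> {f \<in> matchings E J S. f j = s} \<rightarrow> matchings E (J - {j}) (S - {s})"
  proof
    fix f assume f: "f \<in> {f \<in> matchings E J S. f j = s}"
    then have b: "bij_betw f J S" and fj: "f j = s" by (auto simp: matchings_def)
    have b': "bij_betw f (J - {j}) (S - {s})"
      using bij_betw_DiffI[OF b, of "{j}" "{s}"] fj j s by (auto simp: bij_betw_def)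
    then have "bij_betw (f(j := undefined)) (J - {j}) (S - {s})"
      by (subst bij_betw_cong[where g = f]) auto
    then show "f(j := undefined) \<in> matchings E (J - {j}) (S - {s})"
      using f b' by (auto simp: matchings_def PiE_def extensional_def Pi_def dest: bij_betwE)
  qed
  show "(f(j := s))(j := undefined) = f" if "f \<in> matchings E (J - {j}) (S - {s})" for f
    using that by (intro ext) (auto simp: matchings_def PiE_def extensional_def)
  show "(f(j := undefined))(j := s) = f" if "f \<in> {f \<in> matchings E J S. f j = s}" for f
    using that by auto
qed

lemma card_matchings_through:
  assumes "j \<in> J" "s \<in> S" "E j s"
  shows "card {f \<in> matchings E J S. f j = s} = num_matchings E (J - {j}) (S - {s})"
  unfolding num_matchings_def
  by (rule bij_betw_same_card[symmetric], rule bij_betw_matchings_through) (use assms in auto)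

text \<open>
  These are the expansions of a permanent along a row and along a column. The estimates
  for numbers of matchings below rest on these two recurrences.
\<close>

lemma num_matchings_expand_left:
  assumes "finite J" "finite S" "j \<in> J"
  shows "num_matchings E J S = (\<Sum>s | s \<in> S \<and> E j s. num_matchings E (J - {j}) (S - {s}))"
proof -
  have "num_matchings E J S = card (\<Union>s\<in>{s \<in> S. E j s}. {f \<in> matchings E J S. f j = s})"
    unfolding num_matchings_def by (rule arg_cong[where f = card]) (use assms in \<open>auto simp: matchings_def\<close>)
  also have "\<dots> = (\<Sum>s | s \<in> S \<and> E j s. card {f \<in> matchings E J S. f j = s})"
    using assms by (intro card_UN_disjoint) (auto simp: finite_matchings)
  also have "\<dots> = (\<Sum>s | s \<in> S \<and> E j s. num_matchings E (J - {j}) (S - {s}))"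
    using assms by (intro sum.cong) (auto simp: card_matchings_through)
  finally show ?thesis .
qed

lemma num_matchings_expand_right:
  assumes "finite J" "finite S" "s \<in> S"
  shows "num_matchings E J S = (\<Sum>j | j \<in> J \<and> E j s. num_matchings E (J - {j}) (S - {s}))"
proof -
  have "num_matchings E J S = card (\<Union>j\<in>{j \<in> J. E j s}. {f \<in> matchings E J S. f j = s})"
    unfolding num_matchings_def
  proof (rule arg_cong[where f = card], intro equalityI subsetI)
    fix f assume f: "f \<in> matchings E J S"
    then have "s \<in> f ` J" using assms by (auto simp: matchings_def bij_betw_def)
    with f show "f \<in> (\<Union>j\<in>{j \<in> J. E j s}. {f \<in> matchings E J S. f j = s})"
      by (auto simp: matchings_def)
  qed auto
  also have "\<dots> = (\<Sum>j | j \<in> J \<and> E j s. card {f \<in> matchings E J S. f j = s})"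
  proof (intro card_UN_disjoint ballI impI)
    fix j j' assume "j \<in> {j \<in> J. E j s}" "j' \<in> {j \<in> J. E j s}" "j \<noteq> j'"
    then show "{f \<in> matchings E J S. f j = s} \<inter> {f \<in> matchings E J S. f j' = s} = {}"
      by (auto simp: matchings_def bij_betw_def dest: inj_onD)
  qed (use assms in \<open>auto simp: finite_matchings\<close>)
  also have "\<dots> = (\<Sum>j | j \<in> J \<and> E j s. num_matchings E (J - {j}) (S - {s}))"
    using assms by (intro sum.cong) (auto simp: card_matchings_through)
  finally show ?thesis .
qed

lemma num_matchings_empty: "num_matchings E {} S = (if S = {} then 1 else 0)"
  "num_matchings E J {} = (if J = {} then 1 else 0)"
  by (auto simp: num_matchings_def matchings_def bij_betw_def card_eq_0_iff)

lemma num_matchings_transpose: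
  assumes "finite J" "finite S"
  shows "num_matchings E J S = num_matchings (\<lambda>s j. E j s) S J"
  using assms
proof (induction J arbitrary: S rule: finite_induct)
  case empty
  then show ?case by (simp add: num_matchings_empty)
next
  case (insert j J)
  then show ?case
    by (simp add: num_matchings_expand_left[of "insert j J" S j] num_matchings_expand_right[of S "insert j J" j])
qed

text \<open>
  This removes the prescribed cells of a row: a column with a single allowed symbol is matched to it.
\<close>

lemma num_matchings_forced:
  assumes "finite K" "finite J" "finite S" "K \<subseteq> J" "inj_on \<phi> K" "\<phi> ` K \<subseteq> S"
    and "\<And>j s. j \<in> K \<Longrightarrow> E j s \<longleftrightarrow> s = \<phi> j"
  shows "num_matchings E J S = num_matchings E (J - K) (S - \<phi> ` K)"
  using assms
proof (induction K arbitrary: J S rule: finite_induct)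
  case empty
  then show ?case by simp
next
  case (insert j K)
  have "{s \<in> S. E j s} = {\<phi> j}" using insert.prems by auto
  then have "num_matchings E J S = num_matchings E (J - {j}) (S - {\<phi> j})"
    using insert.prems by (subst num_matchings_expand_left[where j = j]) auto
  also have "\<dots> = num_matchings E (J - {j} - K) (S - {\<phi> j} - \<phi> ` K)"
    using insert.prems insert.hyps by (intro insert.IH) (auto, metis imageI)
  finally show ?case by (simp only: image_insert Diff_insert2[of J j K] Diff_insert2[of S "\<phi> j" "\<phi> ` K"])
qed

text \<open>
  Count the pairs of a matching \<open>M\<close> that avoids \<open>t\<close> and a vertex \<open>t' \<in> X\<close>. If the partner
  \<open>j\<close> of \<open>t'\<close> in \<open>M\<close> is adjacent to \<open>t\<close>, moving \<open>j\<close> from \<open>t'\<close> to \<open>t\<close> gives a matching that avoids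
  \<open>t'\<close>, and the pair can be recovered from it. For a fixed \<open>M\<close> the remaining pairs number at most
  the non-neighbours of \<open>t\<close>.
\<close>

lemma num_matchings_reroute:
  assumes fin: "finite J" "finite S" and t: "t \<in> S" and X: "X \<subseteq> S - {t}"
  shows "card X * num_matchings E J (S - {t})
    \<le> (\<Sum>t'\<in>X. num_matchings E J (S - {t'})) + card {j \<in> J. \<not> E j t} * num_matchings E J (S - {t})"
proof -
  define W where "W j t' = (if E j t' then num_matchings E (J - {j}) (S - {t} - {t'}) else 0)" for j t'
  have finX: "finite X" using X fin finite_subset by blast
  have "card X * num_matchings E J (S - {t}) = (\<Sum>t'\<in>X. \<Sum>j\<in>J. W j t')"
  proof -
    have "(\<Sum>j\<in>J. W j t') = num_matchings E J (S - {t})" if "t' \<in> X" for t'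
      unfolding W_def using fin that X
      by (subst num_matchings_expand_right[where s = t']) (auto simp: sum.If_cases Int_def)
    then show ?thesis by simp
  qed
  also have "\<dots> = (\<Sum>t'\<in>X. (\<Sum>j | j \<in> J \<and> E j t. W j t') + (\<Sum>j | j \<in> J \<and> \<not> E j t. W j t'))"
    using fin by (intro sum.cong refl, subst sum.union_disjoint[symmetric]) (auto intro!: sum.cong)
  also have "\<dots> = (\<Sum>t'\<in>X. \<Sum>j | j \<in> J \<and> E j t. W j t') + (\<Sum>j | j \<in> J \<and> \<not> E j t. \<Sum>t'\<in>X. W j t')"
    by (simp add: sum.distrib) (rule sum.swap)
  also have "(\<Sum>t'\<in>X. \<Sum>j | j \<in> J \<and> E j t. W j t') \<le> (\<Sum>t'\<in>X. num_matchings E J (S - {t'}))"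
  proof (rule sum_mono)
    fix t' assume t': "t' \<in> X"
    have "num_matchings E J (S - {t'}) = (\<Sum>j | j \<in> J \<and> E j t. num_matchings E (J - {j}) (S - {t'} - {t}))"
      using fin t t' X by (intro num_matchings_expand_right) auto
    also have "S - {t'} - {t} = S - {t} - {t'}" by auto
    finally show "(\<Sum>j | j \<in> J \<and> E j t. W j t') \<le> num_matchings E J (S - {t'})"
      by (auto simp: W_def intro!: sum_mono)
  qed
  also have "(\<Sum>j | j \<in> J \<and> \<not> E j t. \<Sum>t'\<in>X. W j t') \<le> (\<Sum>j | j \<in> J \<and> \<not> E j t. num_matchings E J (S - {t}))"
  proof (rule sum_mono)
    fix j assume j: "j \<in> {j \<in> J. \<not> E j t}"
    have "(\<Sum>t'\<in>X. W j t') \<le> (\<Sum>t'\<in>S - {t}. W j t')"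
      using fin X by (intro sum_mono2) auto
    also have "\<dots> = num_matchings E J (S - {t})"
      unfolding W_def using fin j
      by (subst num_matchings_expand_left[where j = j]) (auto simp: sum.If_cases Int_def)
    finally show "(\<Sum>t'\<in>X. W j t') \<le> num_matchings E J (S - {t})" .
  qed
  finally show ?thesis by simp
qed

section \<open>Edges of a dense near-regular bipartite graph\<close>

definition near_regular :: "('a \<Rightarrow> 'b \<Rightarrow> bool) \<Rightarrow> 'a set \<Rightarrow> 'b set \<Rightarrow> nat \<Rightarrow> nat \<Rightarrow> bool" where
  "near_regular E J S lo hi \<longleftrightarrow> finite J \<and> finite S \<and>
     (\<forall>j\<in>J. card {s \<in> S. E j s} \<in> {lo..hi}) \<and> (\<forall>s\<in>S. card {j \<in> J. E j s} \<in> {lo..hi})"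

lemma near_regular_transpose: "near_regular E J S lo hi \<Longrightarrow> near_regular (\<lambda>s j. E j s) S J lo hi"
  by (auto simp: near_regular_def)

text \<open>
  Only the vertices of the other side lose neighbours, and each loses at most two. This is the price
  of one round of the contraction below.
\<close>

lemma near_regular_delete_two:
  assumes "near_regular E J S (lo + 2) hi"
  shows "near_regular E (J - {j} - {j'}) S lo hi"
  unfolding near_regular_def
proof (intro conjI ballI)
  show "finite (J - {j} - {j'})" "finite S" using assms by (auto simp: near_regular_def)
  fix i assume "i \<in> J - {j} - {j'}"
  then have "card {s \<in> S. E i s} \<in> {lo + 2..hi}" using assms by (auto simp: near_regular_def)
  then show "card {s \<in> S. E i s} \<in> {lo..hi}" by auto
next
  fix s assume "s \<in> S"
  then have c: "card {i \<in> J. E i s} \<in> {lo + 2..hi}" and fin: "finite J"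
    using assms by (auto simp: near_regular_def)
  have eq: "{i \<in> J - {j} - {j'}. E i s} = {i \<in> J. E i s} - {j, j'}" by auto
  have "card {i \<in> J. E i s} - card {j, j'} \<le> card {i \<in> J - {j} - {j'}. E i s}"
    unfolding eq using fin by (intro diff_card_le_card_Diff) auto
  moreover have "card {j, j'} \<le> 2" by (simp add: card_insert_if)
  moreover have "card {i \<in> J - {j} - {j'}. E i s} \<le> card {i \<in> J. E i s}"
    using fin by (intro card_mono) auto
  ultimately show "card {i \<in> J - {j} - {j'}. E i s} \<in> {lo..hi}" using c by auto
qed

text \<open>
  Some finite bound on the ratio is needed to start the contraction. Expanding each side at the vertex
  that the other one deletes gives sums of the same quantities \<open>h t\<close>, over the neighbours of \<open>j'\<close>
  and over those of \<open>j\<close>. A term outside the second range is bounded by rerouting: since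
  \<open>2 * lo > N\<close>, rerouting succeeds for at least \<open>2 * lo - N\<close> neighbours of \<open>j\<close> on average.
\<close>

lemma num_matchings_delete_crude:
  assumes nr: "near_regular E J S lo hi" and cJ: "card J = Suc (card S)" "card J \<le> N"
    and N: "N < 2 * lo" and j: "j \<in> J" "j' \<in> J"
  shows "real (num_matchings E (J - {j}) S)
    \<le> (1 + real N / (2 * real lo - real N)) * real (num_matchings E (J - {j'}) S)"
proof (cases "j = j'")
  case True
  then show ?thesis using N by (simp add: distrib_right)
next
  case False
  define h where "h t = num_matchings E (J - {j} - {j'}) (S - {t})" for t
  define A where "A = {t \<in> S. E j' t}"
  define B where "B = {t \<in> S. E j t}"
  have fin: "finite J" "finite S" and deg: "lo \<le> card B" "\<And>t. t \<in> S \<Longrightarrow> lo \<le> card {i \<in> J. E i t}"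
    using nr j by (auto simp: near_regular_def B_def)
  have uj: "num_matchings E (J - {j}) S = sum h A"
    unfolding h_def A_def using fin j False by (intro num_matchings_expand_left) auto
  have "num_matchings E (J - {j'}) S = (\<Sum>t | t \<in> S \<and> E j t. num_matchings E (J - {j'} - {j}) (S - {t}))"
    using fin j False by (intro num_matchings_expand_left) auto
  also have "\<dots> = sum h B"
    by (simp add: h_def B_def Diff_insert2[of J, symmetric] insert_commute)
  finally have uj': "num_matchings E (J - {j'}) S = sum h B" .
  define D where "D = 2 * real lo - real N"
  have D: "D > 0" using N by (simp add: D_def)
  have out: "real (h t) \<le> real (sum h B) / D" if t: "t \<in> A - B" for t
  proof -
    have tS: "t \<in> S" using t by (auto simp: A_def)
    have "card B * h t \<le> (\<Sum>t'\<in>B. h t') + card {i \<in> J - {j} - {j'}. \<not> E i t} * h t"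
      unfolding h_def by (rule num_matchings_reroute) (use fin tS t in \<open>auto simp: B_def\<close>)
    moreover have "card {i \<in> J - {j} - {j'}. \<not> E i t} \<le> N - lo"
    proof -
      have "card {i \<in> J - {j} - {j'}. \<not> E i t} \<le> card (J - {i \<in> J. E i t})"
        using fin by (intro card_mono) auto
      also have "\<dots> = card J - card {i \<in> J. E i t}" using fin by (intro card_Diff_subset) auto
      finally show ?thesis using deg(2)[OF tS] cJ by linarith
    qed
    ultimately have "lo * h t \<le> sum h B + (N - lo) * h t"
      using deg(1) by (meson add_left_mono le_trans mult_le_mono1)
    then have "real (lo * h t) \<le> real (sum h B + (N - lo) * h t)" by (rule of_nat_mono)
    moreover have "lo \<le> N"
      using deg(2)[OF tS] cJ card_mono[OF fin(1), of "{i \<in> J. E i t}"] by auto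
    ultimately have "real lo * real (h t) \<le> real (sum h B) + (real N - real lo) * real (h t)"
      by (simp only: of_nat_mult of_nat_add of_nat_diff)
    then have "D * real (h t) \<le> real (sum h B)" by (simp add: D_def algebra_simps)
    then show ?thesis using D by (simp add: field_simps)
  qed
  have "real (sum h A) = real (sum h (A \<inter> B)) + (\<Sum>t\<in>A - B. real (h t))"
    using fin by (subst sum.Int_Diff[of A h B]) (auto simp: A_def)
  also have "real (sum h (A \<inter> B)) \<le> real (sum h B)"
    using fin by (intro of_nat_mono sum_mono2) (auto simp: B_def)
  also have "(\<Sum>t\<in>A - B. real (h t)) \<le> real (card (A - B)) * (real (sum h B) / D)"
    using out by (intro sum_bounded_above) auto
  also have "\<dots> \<le> real N * (real (sum h B) / D)"
  proof (intro mult_right_mono)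
    have "card (A - B) \<le> card S" using fin by (intro card_mono) (auto simp: A_def)
    then show "real (card (A - B)) \<le> real N" using cJ by simp
  qed (use D in \<open>auto intro!: divide_nonneg_pos sum_nonneg\<close>)
  finally show ?thesis unfolding uj uj' D_def[symmetric] by (simp add: algebra_simps)
qed

text \<open>
  The two sums share the terms in \<open>A \<inter> B\<close>, so a discrepancy \<open>\<rho>\<close> between single terms
  affects only \<open>A - B\<close> and \<open>B - A\<close>. As \<open>A \<union> B\<close> has at most \<open>N\<close> elements, these parts have at most
  \<open>N - lo\<close> elements each, and their sizes differ by at most \<open>hi - lo\<close>. When \<open>lo\<close> exceeds half of \<open>N\<close> by a fixed proportion,
  they are smaller than \<open>B\<close> by a constant factor, so the relative error shrinks by the factor
  \<open>\<theta> < 1\<close>, up to the term \<open>\<omega>\<close> that accounts for irregular degrees.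
\<close>

lemma sum_contraction:
  fixes h :: "'a \<Rightarrow> real" and lo hi N :: nat
  assumes fin: "finite S" "card S \<le> N" and sub: "A \<subseteq> S" "B \<subseteq> S"
    and A: "card A \<in> {lo..hi}" and B: "card B \<in> {lo..hi}"
    and h: "\<And>t. t \<in> S \<Longrightarrow> 0 \<le> h t" "\<And>t t'. t \<in> S \<Longrightarrow> t' \<in> S \<Longrightarrow> h t \<le> \<rho> * h t'"
    and \<rho>: "1 \<le> \<rho>" and lo: "0 < lo"
    and \<theta>: "real N - real lo + (real hi - real lo) \<le> \<theta> * real lo"
    and \<omega>: "real hi - real lo \<le> \<omega> * real lo"
  shows "sum h A \<le> (1 + \<theta> * (\<rho> - 1) + \<omega>) * sum h B"
proof -
  have ne: "S \<noteq> {}" using A lo sub by auto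
  define x where "x = Min (h ` S)"
  have x: "x \<in> h ` S" "\<And>t. t \<in> S \<Longrightarrow> x \<le> h t" unfolding x_def using fin ne by auto
  have x0: "0 \<le> x" using x(1) h by auto
  have up: "h t \<le> \<rho> * x" if "t \<in> S" for t using x(1) h(2) that by auto
  have finAB: "finite A" "finite B" using sub fin finite_subset by auto
  define p q where "p = real (card (B - A))" and "q = real (card (A - B))"
  define w where "w = real hi - real lo"
  have i: "card A = card (A \<inter> B) + card (A - B)" "card B = card (A \<inter> B) + card (B - A)"
    using card_Int_Diff[of A B] card_Int_Diff[of B A] finAB by (auto simp: Int_commute)
  have qp: "q \<le> p + w" unfolding p_def q_def w_def using i A B by auto
  have "card (A \<union> (B - A)) \<le> card S" using fin sub by (intro card_mono) auto
  then have "card A + card (B - A) \<le> N" using finAB fin by (subst (asm) card_Un_disjoint) auto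
  then have p: "0 \<le> p" "p \<le> real N - real lo" unfolding p_def using A by auto
  have "sum h A - sum h B = sum h (A - B) - sum h (B - A)"
    using sum.Int_Diff[of A h B] sum.Int_Diff[of B h A] finAB by (simp add: Int_commute)
  also have "\<dots> \<le> (p + w) * (\<rho> * x) - p * x"
  proof (rule diff_mono)
    have "sum h (A - B) \<le> q * (\<rho> * x)"
      unfolding q_def using up sub by (intro sum_bounded_above) auto
    also have "\<dots> \<le> (p + w) * (\<rho> * x)" using qp \<rho> x0 by (intro mult_right_mono) auto
    finally show "sum h (A - B) \<le> (p + w) * (\<rho> * x)" .
    show "p * x \<le> sum h (B - A)"
      unfolding p_def using x(2) sub by (intro sum_bounded_below) auto
  qed
  also have "(p + w) * (\<rho> * x) - p * x = ((p + w) * (\<rho> - 1) + w) * x" by (simp add: algebra_simps)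
  also have "\<dots> \<le> (\<theta> * real lo * (\<rho> - 1) + \<omega> * real lo) * x"
  proof (intro mult_right_mono add_mono)
    show "p + w \<le> \<theta> * real lo" using p \<theta> by (simp add: w_def)
  qed (use \<rho> \<omega> x0 in \<open>auto simp: w_def\<close>)
  also have "\<dots> = (\<theta> * (\<rho> - 1) + \<omega>) * (real lo * x)" by (simp add: algebra_simps)
  also have "\<dots> \<le> (\<theta> * (\<rho> - 1) + \<omega>) * sum h B"
  proof (intro mult_left_mono)
    have "real lo * x \<le> real (card B) * x" using B x0 by (intro mult_right_mono) auto
    also have "\<dots> \<le> sum h B" using x(2) sub by (intro sum_bounded_below) auto
    finally show "real lo * x \<le> sum h B" .
    have "0 \<le> p + w" "0 \<le> w" using p A by (auto simp: w_def)
    then have "0 \<le> \<theta> * real lo" "0 \<le> \<omega> * real lo" using \<theta> \<omega> p by (auto simp: w_def)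
    then have "0 \<le> \<theta>" "0 \<le> \<omega>" using lo by (auto simp: zero_le_mult_iff)
    then show "0 \<le> \<theta> * (\<rho> - 1) + \<omega>" using \<rho> by auto
  qed
  finally show ?thesis by (simp add: algebra_simps)
qed

text \<open>
  Deleting \<open>j\<close> instead of \<open>j'\<close> from the larger side hardly matters. The expansions at \<open>j'\<close> and at
  \<open>j\<close> are sums over two large neighbourhoods of the same quantities, which are again matching
  numbers after deleting one vertex from the larger side, with the two sides exchanged. So
  \<open>sum_contraction\<close> can be iterated, and the crude bound is damped \<open>l\<close> times. Both sides of the
  graph are subsets of one type because the induction exchanges them.
\<close>

lemma num_matchings_delete_ratio:
  fixes E :: "'a \<Rightarrow> 'a \<Rightarrow> bool" and lo hi N l :: nat
  assumes nr: "near_regular E J S (lo + 2 * l) hi" and cJ: "card J = Suc (card S)" "card J \<le> N"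
    and j: "j \<in> J" "j' \<in> J" and N: "N < 2 * lo" and le: "lo \<le> N" "lo \<le> hi"
    and \<theta>: "real N - real lo + (real hi - real lo) \<le> \<theta> * real lo" "\<theta> < 1"
    and \<omega>: "real hi - real lo \<le> \<omega> * real lo"
  shows "real (num_matchings E (J - {j}) S)
    \<le> (1 + \<theta> ^ l * (real N / (2 * real lo - real N)) + \<omega> / (1 - \<theta>)) * real (num_matchings E (J - {j'}) S)"
proof -
  have lo: "0 < lo" using N by auto
  have "0 \<le> \<theta> * real lo" "0 \<le> \<omega> * real lo" using \<theta>(1) \<omega> le by linarith+
  then have pos: "0 \<le> \<theta>" "0 \<le> \<omega>" using lo by (auto simp: zero_le_mult_iff)
  define \<sigma> where "\<sigma> = real N / (2 * real lo - real N)"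
  have \<sigma>: "0 \<le> \<sigma>" using N by (simp add: \<sigma>_def)
  show ?thesis using nr cJ j unfolding \<sigma>_def[symmetric]
  proof (induction l arbitrary: E J S j j')
    case 0
    have "real (num_matchings E (J - {j}) S) \<le> (1 + \<sigma>) * real (num_matchings E (J - {j'}) S)"
      unfolding \<sigma>_def using 0 N by (intro num_matchings_delete_crude) auto
    also have "\<dots> \<le> (1 + \<sigma> + \<omega> / (1 - \<theta>)) * real (num_matchings E (J - {j'}) S)"
      using pos \<theta>(2) by (intro mult_right_mono) auto
    finally show ?case by simp
  next
    case (Suc l)
    define \<rho> where "\<rho> = 1 + \<theta> ^ l * \<sigma> + \<omega> / (1 - \<theta>)"
    have \<rho>: "1 \<le> \<rho>" using pos \<sigma> \<theta>(2) by (simp add: \<rho>_def)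
    have step: "1 + \<theta> * (\<rho> - 1) + \<omega> = 1 + \<theta> ^ Suc l * \<sigma> + \<omega> / (1 - \<theta>)"
      using \<theta>(2) by (simp add: \<rho>_def field_simps)
    show ?case
    proof (cases "j = j'")
      case True
      have "1 * real (num_matchings E (J - {j'}) S)
        \<le> (1 + \<theta> ^ Suc l * \<sigma> + \<omega> / (1 - \<theta>)) * real (num_matchings E (J - {j'}) S)"
        using pos \<sigma> \<theta>(2) by (intro mult_right_mono) auto
      then show ?thesis using True by simp
    next
      case False
      define h where "h t = num_matchings E (J - {j} - {j'}) (S - {t})" for t
      have fin: "finite J" "finite S" using Suc.prems by (auto simp: near_regular_def)
      have "num_matchings E (J - {j}) S = (\<Sum>t | t \<in> S \<and> E j' t. h t)"
        unfolding h_def using fin Suc.prems False by (intro num_matchings_expand_left) auto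
      then have uj: "real (num_matchings E (J - {j}) S) = (\<Sum>t | t \<in> S \<and> E j' t. real (h t))" by simp
      have "num_matchings E (J - {j'}) S = (\<Sum>t | t \<in> S \<and> E j t. num_matchings E (J - {j'} - {j}) (S - {t}))"
        using fin Suc.prems False by (intro num_matchings_expand_left) auto
      also have "\<dots> = (\<Sum>t | t \<in> S \<and> E j t. h t)"
        by (simp add: h_def Diff_insert2[of J, symmetric] insert_commute)
      finally have uj': "real (num_matchings E (J - {j'}) S) = (\<Sum>t | t \<in> S \<and> E j t. real (h t))" by simp
      have nr': "near_regular E (J - {j} - {j'}) S (lo + 2 * l) hi"
        by (rule near_regular_delete_two) (use Suc.prems in \<open>simp add: algebra_simps\<close>)
      have cS: "card S = Suc (card (J - {j} - {j'}))"
        using Suc.prems(2) card_Suc_Diff1[OF fin(1) Suc.prems(4)] False Suc.prems(5) fin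
          card_Suc_Diff1[of "J - {j}" j'] by simp
      have hr: "real (h t) \<le> \<rho> * real (h t')" if "t \<in> S" "t' \<in> S" for t t'
        using Suc.IH[OF near_regular_transpose[OF nr'] cS _ that] Suc.prems fin
        by (simp add: h_def \<rho>_def num_matchings_transpose[where J = "J - {j} - {j'}"])
      have "(\<Sum>t | t \<in> S \<and> E j' t. real (h t))
          \<le> (1 + \<theta> * (\<rho> - 1) + \<omega>) * (\<Sum>t | t \<in> S \<and> E j t. real (h t))"
        by (rule sum_contraction[where S = S and N = N and lo = lo and hi = hi])
          (use Suc.prems fin hr \<rho> lo \<theta> \<omega> in \<open>auto simp: near_regular_def\<close>)
      then show ?thesis unfolding uj uj' step .
    qed
  qed
qed

text \<open>
  In a uniformly random perfect matching every edge has probability between \<open>1 / (\<rho> * hi)\<close>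
  and \<open>\<rho> / lo\<close>; the inequalities are multiplied out so that they make sense when there is
  no perfect matching.
\<close>

definition uniform_edges ::
    "real \<Rightarrow> nat \<Rightarrow> nat \<Rightarrow> ('a \<Rightarrow> 'b \<Rightarrow> bool) \<Rightarrow> 'a set \<Rightarrow> 'b set \<Rightarrow> bool" where
  "uniform_edges \<rho> lo hi E J S \<longleftrightarrow> (\<forall>j\<in>J. \<forall>s\<in>S. E j s \<longrightarrow>
     real lo * real (num_matchings E (J - {j}) (S - {s})) \<le> \<rho> * real (num_matchings E J S) \<and>
     real (num_matchings E J S) \<le> \<rho> * real hi * real (num_matchings E (J - {j}) (S - {s})))"

text \<open>
  The edges at \<open>j\<close> partition the perfect matchings into at least \<open>lo\<close> and at most \<open>hi\<close> classes, and
  by \<open>num_matchings_delete_ratio\<close> the sizes of these classes agree up to the factor \<open>\<rho>\<close>.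
\<close>

lemma uniform_edgesI:
  fixes E :: "'a \<Rightarrow> 'a \<Rightarrow> bool"
  assumes nr: "near_regular E J S lo hi" and cJ: "card J = card S" "card S \<le> N"
    and lo: "lo = lo' + 2 * l + 1" and N: "N < 2 * lo'" and le: "lo' \<le> N" "lo' \<le> hi"
    and \<theta>: "real N - real lo' + (real hi - real lo') \<le> \<theta> * real lo'" "\<theta> < 1"
    and \<omega>: "real hi - real lo' \<le> \<omega> * real lo'"
    and \<rho>: "1 + \<theta> ^ l * (real N / (2 * real lo' - real N)) + \<omega> / (1 - \<theta>) \<le> \<rho>"
  shows "uniform_edges \<rho> lo hi E J S"
  unfolding uniform_edges_def
proof (intro ballI impI)
  fix j s assume j: "j \<in> J" and s: "s \<in> S" and E: "E j s"
  have fin: "finite J" "finite S" using nr by (auto simp: near_regular_def)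
  have "0 \<le> \<theta> * real lo'" "0 \<le> \<omega> * real lo'" using \<theta>(1) \<omega> le by linarith+
  then have pos: "0 \<le> \<theta>" "0 \<le> \<omega>" using N by (auto simp: zero_le_mult_iff)
  have "0 \<le> \<theta> ^ l * (real N / (2 * real lo' - real N))" "0 \<le> \<omega> / (1 - \<theta>)"
    using pos \<theta> N by auto
  then have \<rho>0: "0 \<le> \<rho>" using \<rho> by linarith
  define a where "a t = num_matchings E (J - {j}) (S - {t})" for t
  have nr': "near_regular (\<lambda>s j. E j s) S (J - {j}) (lo' + 2 * l) hi"
    unfolding near_regular_def
  proof (intro conjI ballI)
    show "finite S" "finite (J - {j})" using fin by auto
    fix i assume "i \<in> J - {j}"
    then have "card {s \<in> S. E i s} \<in> {lo..hi}" using nr by (auto simp: near_regular_def)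
    then show "card {s \<in> S. E i s} \<in> {lo' + 2 * l..hi}" by (auto simp: lo)
  next
    fix t assume "t \<in> S"
    then have c: "card {i \<in> J. E i t} \<in> {lo..hi}" using nr by (auto simp: near_regular_def)
    have eq: "{i \<in> J - {j}. E i t} = {i \<in> J. E i t} - {j}" by auto
    have "card {i \<in> J. E i t} - 1 \<le> card {i \<in> J - {j}. E i t}"
      unfolding eq using fin diff_card_le_card_Diff[of "{j}" "{i \<in> J. E i t}"] by auto
    moreover have "card {i \<in> J - {j}. E i t} \<le> card {i \<in> J. E i t}"
      using fin by (intro card_mono) auto
    ultimately show "card {i \<in> J - {j}. E i t} \<in> {lo' + 2 * l..hi}" using c by (auto simp: lo)
  qed
  have cS: "card S = Suc (card (J - {j}))" using cJ(1) card_Suc_Diff1[OF fin(1) j] by simp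
  have r: "real (a t) \<le> \<rho> * real (a t')" if "t \<in> S" "t' \<in> S" for t t'
  proof -
    have "real (a t) \<le> (1 + \<theta> ^ l * (real N / (2 * real lo' - real N)) + \<omega> / (1 - \<theta>)) * real (a t')"
      using num_matchings_delete_ratio[OF nr' cS cJ(2) that N le \<theta> \<omega>] fin
      by (simp add: a_def num_matchings_transpose[where J = "J - {j}"])
    also have "\<dots> \<le> \<rho> * real (a t')" using \<rho> by (intro mult_right_mono) auto
    finally show ?thesis .
  qed
  have "num_matchings E J S = (\<Sum>t | t \<in> S \<and> E j t. a t)"
    unfolding a_def using fin j by (rule num_matchings_expand_left)
  then have per: "real (num_matchings E J S) = (\<Sum>t | t \<in> S \<and> E j t. real (a t))" by simp
  have deg: "card {t \<in> S. E j t} \<in> {lo..hi}" using nr j by (auto simp: near_regular_def)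
  show "real lo * real (num_matchings E (J - {j}) (S - {s})) \<le> \<rho> * real (num_matchings E J S) \<and>
     real (num_matchings E J S) \<le> \<rho> * real hi * real (num_matchings E (J - {j}) (S - {s}))"
    unfolding a_def[symmetric]
  proof
    have "real lo * real (a s) \<le> real (card {t \<in> S. E j t}) * real (a s)"
      using deg by (intro mult_right_mono) auto
    also have "\<dots> \<le> (\<Sum>t | t \<in> S \<and> E j t. \<rho> * real (a t))"
      using r s by (intro sum_bounded_below) auto
    finally show "real lo * real (a s) \<le> \<rho> * real (num_matchings E J S)" by (simp add: per sum_distrib_left)
    have "real (num_matchings E J S) \<le> real (card {t \<in> S. E j t}) * (\<rho> * real (a s))"
      unfolding per using r s by (intro sum_bounded_above) auto
    also have "\<dots> \<le> real hi * (\<rho> * real (a s))"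
      using deg \<rho>0 by (intro mult_right_mono) auto
    finally show "real (num_matchings E J S) \<le> \<rho> * real hi * real (a s)" by (simp add: mult_ac)
  qed
qed

section \<open>Resampling one row of a Latin rectangle\<close>

definition completions ::
    "nat \<Rightarrow> nat \<Rightarrow> (nat \<times> nat) set \<Rightarrow> (nat \<Rightarrow> nat \<Rightarrow> nat) \<Rightarrow> (nat \<Rightarrow> nat \<Rightarrow> nat) set" where
  "completions k n D F = {L \<in> latin_rectangles k n. \<forall>(i, j)\<in>D. L i j = F i j}"

text \<open>
  The bipartite graph of columns and symbols whose perfect matchings are the possible rows \<open>i\<close> when
  the other rows of \<open>L\<close> are kept. Cells prescribed by \<open>D\<close> become columns with a single neighbour.
\<close>

definition allowed ::
    "nat \<Rightarrow> (nat \<times> nat) set \<Rightarrow> (nat \<Rightarrow> nat \<Rightarrow> nat) \<Rightarrow> nat \<Rightarrow> (nat \<Rightarrow> nat \<Rightarrow> nat) \<Rightarrow> nat \<Rightarrow> nat \<Rightarrow> bool" where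
  "allowed k D F i L j s \<longleftrightarrow>
     (if (i, j) \<in> D then s = F i j else \<forall>i'\<in>{1..k} - {i}. L i' j \<noteq> s)"

lemma finite_latin_rectangles: "finite (latin_rectangles k n)"
proof (rule finite_subset)
  show "latin_rectangles k n \<subseteq> {1..k} \<rightarrow>\<^sub>E {1..n} \<rightarrow>\<^sub>E {1..n}" by (auto simp: latin_rectangles_def)
qed (auto intro!: finite_PiE)

lemma finite_completions: "finite (completions k n D F)"
  unfolding completions_def using finite_latin_rectangles by auto

lemma latin_rectangles_row:
  assumes "L \<in> latin_rectangles k n" "i \<in> {1..k}"
  shows "L i \<in> {1..n} \<rightarrow>\<^sub>E {1..n}" "bij_betw (L i) {1..n} {1..n}"
  using assms by (auto simp: latin_rectangles_def)

lemma latin_rectangles_column: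
  assumes "L \<in> latin_rectangles k n" "j \<in> {1..n}" "i \<in> {1..k}" "i' \<in> {1..k}" "L i j = L i' j"
  shows "i = i'"
proof -
  have "inj_on (\<lambda>i. L i j) {1..k}" using assms(1,2) unfolding latin_rectangles_def by blast
  then show ?thesis by (rule inj_onD) (use assms in auto)
qed

lemma bij_betw_row_completions:
  assumes L: "L \<in> completions k n D F" and i: "i \<in> {1..k}"
  shows "bij_betw (\<lambda>f. L(i := f)) (matchings (allowed k D F i L) {1..n} {1..n})
           {L' \<in> completions k n D F. L'(i := undefined) = L(i := undefined)}"
proof (rule bij_betwI[where g = "\<lambda>L'. L' i"])
  have LR: "L \<in> latin_rectangles k n" and LD: "\<And>i j. (i, j) \<in> D \<Longrightarrow> L i j = F i j"
    using L by (auto simp: completions_def)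
  show "(\<lambda>f. L(i := f)) \<in> matchings (allowed k D F i L) {1..n} {1..n} \<rightarrow>
      {L' \<in> completions k n D F. L'(i := undefined) = L(i := undefined)}"
  proof
    fix f assume "f \<in> matchings (allowed k D F i L) {1..n} {1..n}"
    then have f: "f \<in> {1..n} \<rightarrow>\<^sub>E {1..n}" "bij_betw f {1..n} {1..n}"
      "\<And>j. j \<in> {1..n} \<Longrightarrow> allowed k D F i L j (f j)" by (auto simp: matchings_def)
    have avoid: "L i' j \<noteq> f j" if "j \<in> {1..n}" "i' \<in> {1..k} - {i}" for i' j
    proof (cases "(i, j) \<in> D")
      case True
      then have "f j = L i j" using f(3)[OF that(1)] LD by (auto simp: allowed_def)
      then show ?thesis using latin_rectangles_column[OF LR that(1), of i' i] that i by auto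
    next
      case False
      then show ?thesis using f(3)[OF that(1)] that by (auto simp: allowed_def)
    qed
    have outside: "(i, j) \<notin> D \<or> f j = F i j" for j
    proof (cases "j \<in> {1..n}")
      case True
      then show ?thesis using f(3)[OF True] by (auto simp: allowed_def)
    next
      case False
      then have "f j = undefined" "L i j = undefined"
        using f(1) latin_rectangles_row(1)[OF LR i] by (auto simp: PiE_def extensional_def)
      then show ?thesis using LD by auto
    qed
    have "L(i := f) \<in> latin_rectangles k n"
      unfolding latin_rectangles_def
    proof (intro CollectI conjI ballI)
      show "L(i := f) \<in> {1..k} \<rightarrow>\<^sub>E {1..n} \<rightarrow>\<^sub>E {1..n}"
      proof (rule PiE_I)
        fix x assume "x \<in> {1..k}"
        then show "(L(i := f)) x \<in> {1..n} \<rightarrow>\<^sub>E {1..n}"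
          using f(1) latin_rectangles_row(1)[OF LR, of x] by (cases "x = i") auto
      next
        fix x assume "x \<notin> {1..k}"
        then show "(L(i := f)) x = undefined"
          using LR i by (auto simp: latin_rectangles_def PiE_def extensional_def)
      qed
      show "bij_betw ((L(i := f)) x) {1..n} {1..n}" if "x \<in> {1..k}" for x
        using f(2) latin_rectangles_row(2)[OF LR that] by (cases "x = i") auto
      show "inj_on (\<lambda>x. (L(i := f)) x j) {1..k}" if j: "j \<in> {1..n}" for j
      proof (rule inj_onI)
        fix x y assume xy: "x \<in> {1..k}" "y \<in> {1..k}" "(L(i := f)) x j = (L(i := f)) y j"
        then show "x = y"
          using avoid[OF j, of x] avoid[OF j, of y] latin_rectangles_column[OF LR j xy(1,2)]
          by (cases "x = i"; cases "y = i") auto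
      qed
    qed
    then show "L(i := f) \<in> {L' \<in> completions k n D F. L'(i := undefined) = L(i := undefined)}"
      using outside LD by (auto simp: completions_def)
  qed
  show "(\<lambda>L'. L' i) \<in> {L' \<in> completions k n D F. L'(i := undefined) = L(i := undefined)} \<rightarrow>
      matchings (allowed k D F i L) {1..n} {1..n}"
  proof
    fix L' assume "L' \<in> {L' \<in> completions k n D F. L'(i := undefined) = L(i := undefined)}"
    then have L': "L' \<in> latin_rectangles k n" "\<And>i j. (i, j) \<in> D \<Longrightarrow> L' i j = F i j"
      and eq: "L'(i := undefined) = L(i := undefined)" by (auto simp: completions_def)
    have same: "L' i' = L i'" if "i' \<noteq> i" for i' using fun_cong[OF eq, of i'] that by simp
    have avoid: "L i' j \<noteq> L' i j" if "j \<in> {1..n}" "i' \<in> {1..k} - {i}" for i' j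
    proof
      assume "L i' j = L' i j"
      then have "L' i' j = L' i j" using same[of i'] that by simp
      then show False using latin_rectangles_column[OF L'(1) that(1), of i' i] that i by simp
    qed
    have "allowed k D F i L j (L' i j)" if "j \<in> {1..n}" for j
      unfolding allowed_def using L'(2)[of i j] avoid[OF that] by (simp del: Diff_iff)
    then show "L' i \<in> matchings (allowed k D F i L) {1..n} {1..n}"
      using latin_rectangles_row[OF L'(1) i] by (auto simp: matchings_def)
  qed
  show "(L(i := f)) i = f" for f by simp
  show "L(i := L' i) = L'"
    if "L' \<in> {L' \<in> completions k n D F. L'(i := undefined) = L(i := undefined)}" for L'
  proof
    fix x
    have eq: "L'(i := undefined) = L(i := undefined)" using that by simp
    show "(L(i := L' i)) x = L' x" using fun_cong[OF eq, of x] by (cases "x = i") simp_all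
  qed
qed

text \<open>
  The other \<open>k - 1\<close> rows forbid exactly \<open>k - 1\<close> symbols in each column, and exactly \<open>k - 1\<close> columns
  for each symbol, as every row contains every symbol once. Removing the prescribed columns and
  symbols lowers a degree by at most \<open>m\<close>.
\<close>

lemma near_regular_allowed:
  fixes F :: "nat \<Rightarrow> nat \<Rightarrow> nat" and D :: "(nat \<times> nat) set" and i :: nat
  defines "K \<equiv> {j. (i, j) \<in> D}"
  assumes L: "L \<in> latin_rectangles k n" and i: "i \<in> {1..k}" and kn: "k \<le> n"
    and K: "K \<subseteq> {1..n}" "card K \<le> m"
  shows "near_regular (allowed k D F i L) ({1..n} - K) ({1..n} - F i ` K)
           (n - k + 1 - m) (n - k + 1)"
proof -
  have finK: "finite K" using finite_subset[OF K(1)] by simp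
  have cV: "card (F i ` K) \<le> m" using card_image_le[OF finK, of "F i"] K by linarith
  have bounds: "card ({1..n} - T - W) \<in> {n - k + 1 - m..n - k + 1}"
    if "card T = k - 1" "T \<subseteq> {1..n}" "finite W" "card W \<le> m" for T W :: "nat set"
  proof -
    have "card ({1..n} - T) = n - (k - 1)"
      using that finite_subset[OF that(2)] by (subst card_Diff_subset) auto
    then have c: "card ({1..n} - T) = n - k + 1" using i kn by auto
    have "card ({1..n} - T) - card W \<le> card ({1..n} - T - W)"
      using that by (intro diff_card_le_card_Diff) auto
    moreover have "card ({1..n} - T - W) \<le> card ({1..n} - T)" by (intro card_mono) auto
    ultimately show ?thesis using c that(4) by auto
  qed
  show ?thesis
    unfolding near_regular_def
  proof (intro conjI ballI)
    show "finite ({1..n} - K)" "finite ({1..n} - F i ` K)" by (rule finite_Diff, rule finite_atLeastAtMost)+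
    fix j assume j: "j \<in> {1..n} - K"
    define T where "T = (\<lambda>i'. L i' j) ` ({1..k} - {i})"
    have "inj_on (\<lambda>i'. L i' j) ({1..k} - {i})"
      by (rule inj_onI, rule latin_rectangles_column[OF L]) (use j in auto)
    then have cT: "card T = k - 1" using i by (simp add: T_def card_image)
    have TS: "T \<subseteq> {1..n}"
    proof
      fix t assume "t \<in> T"
      then obtain i' where "i' \<in> {1..k}" "t = L i' j" unfolding T_def by blast
      then show "t \<in> {1..n}" using latin_rectangles_row(1)[OF L, of i'] j by auto
    qed
    have "{s \<in> {1..n} - F i ` K. allowed k D F i L j s} = {1..n} - T - F i ` K"
      using j by (auto simp: allowed_def T_def K_def)
    then show "card {s \<in> {1..n} - F i ` K. allowed k D F i L j s} \<in> {n - k + 1 - m..n - k + 1}"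
      using bounds[OF cT TS _ cV] finK by auto
  next
    fix s assume s: "s \<in> {1..n} - F i ` K"
    define c where "c i' = inv_into {1..n} (L i') s" for i'
    have c: "c i' \<in> {1..n}" "L i' (c i') = s" if "i' \<in> {1..k}" for i'
    proof -
      have "s \<in> L i' ` {1..n}" using latin_rectangles_row(2)[OF L that] s by (auto simp: bij_betw_def)
      then show "c i' \<in> {1..n}" "L i' (c i') = s"
        unfolding c_def by (rule inv_into_into, rule f_inv_into_f)
    qed
    have c_eq: "c i' = j" if "i' \<in> {1..k}" "j \<in> {1..n}" "L i' j = s" for i' j
    proof -
      have "inj_on (L i') {1..n}" using latin_rectangles_row(2)[OF L that(1)] by (simp add: bij_betw_def)
      from inv_into_f_f[OF this that(2)] show ?thesis by (simp add: c_def that(3))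
    qed
    define T where "T = c ` ({1..k} - {i})"
    have "inj_on c ({1..k} - {i})"
    proof (rule inj_onI)
      fix x y assume "x \<in> {1..k} - {i}" "y \<in> {1..k} - {i}" "c x = c y"
      then show "x = y" using c[of x] c[of y] by (intro latin_rectangles_column[OF L, of "c x" x y]) auto
    qed
    then have cT: "card T = k - 1" using i by (simp add: T_def card_image)
    have TS: "T \<subseteq> {1..n}" using c by (auto simp: T_def)
    have "{j \<in> {1..n} - K. allowed k D F i L j s} = {1..n} - T - K"
    proof -
      have "j \<in> T \<longleftrightarrow> (\<exists>i'\<in>{1..k} - {i}. L i' j = s)" if "j \<in> {1..n}" for j
      proof
        assume "j \<in> T"
        then obtain i' where i': "i' \<in> {1..k} - {i}" "j = c i'" unfolding T_def by blast
        then show "\<exists>i'\<in>{1..k} - {i}. L i' j = s" using c(2)[of i'] by blast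
      next
        assume "\<exists>i'\<in>{1..k} - {i}. L i' j = s"
        then obtain i' where i': "i' \<in> {1..k} - {i}" "L i' j = s" by blast
        then have "c i' = j" using c_eq[of i' j] that by blast
        then show "j \<in> T" using i' unfolding T_def by blast
      qed
      then have "allowed k D F i L j s \<longleftrightarrow> j \<notin> T" if "j \<in> {1..n} - K" for j
        using that by (simp add: allowed_def K_def)
      then show ?thesis by blast
    qed
    then show "card {j \<in> {1..n} - K. allowed k D F i L j s} \<in> {n - k + 1 - m..n - k + 1}"
      using bounds[OF cT TS finK K(2)] by simp
  qed
qed

text \<open>
  Group the rectangles in \<open>A\<close> by their rows other than \<open>i\<close>. Whether a rectangle lies in \<open>B\<close> depends
  only on its group. Within a group contained in \<open>B\<close>, row \<open>i\<close> is a uniformly random perfect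
  matching and the edge from \<open>j\<close> to \<open>s\<close> is available, so it is used with probability about
  \<open>1 / hi\<close>. Groups outside \<open>B\<close> contribute nothing to \<open>X\<close>.
\<close>

lemma row_resample:
  fixes F :: "nat \<Rightarrow> nat \<Rightarrow> nat" and \<rho> :: real and k n m i j s :: nat and D :: "(nat \<times> nat) set"
  defines "lo \<equiv> n - k + 1 - m" and "hi \<equiv> n - k + 1"
  defines "A \<equiv> completions k n D F"
  defines "X \<equiv> {L \<in> A. L i j = s}"
  defines "B \<equiv> {L \<in> A. \<forall>i'\<in>{1..k} - {i}. L i' j \<noteq> s}"
  defines "K \<equiv> {j. (i, j) \<in> D}"
  assumes i: "i \<in> {1..k}" and kn: "k \<le> n"
    and K: "K \<subseteq> {1..n}" "card K \<le> m" "inj_on (F i) K" "F i ` K \<subseteq> {1..n}"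
    and j: "j \<in> {1..n} - K" and s: "s \<in> {1..n} - F i ` K"
    and UE: "\<And>E (J::nat set) (S::nat set). near_regular E J S lo hi \<Longrightarrow> card J = card S \<Longrightarrow> card S \<le> n
               \<Longrightarrow> uniform_edges \<rho> lo hi E J S"
  shows "real lo * real (card X) \<le> \<rho> * real (card B)"
    and "real (card B) \<le> \<rho> * real hi * real (card X)"
proof -
  define r :: "(nat \<Rightarrow> nat \<Rightarrow> nat) \<Rightarrow> nat \<Rightarrow> nat \<Rightarrow> nat" where "r L = L(i := undefined)" for L
  have finA: "finite A" unfolding A_def by (rule finite_completions)
  have finB: "finite B" and finX: "finite X" using finA by (auto simp: B_def X_def)
  have finK: "finite K" using finite_subset[OF K(1)] by simp
  have XB: "X \<subseteq> B"
  proof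
    fix L assume "L \<in> X"
    then have L: "L \<in> A" "L \<in> latin_rectangles k n" "L i j = s"
      by (auto simp: X_def A_def completions_def)
    have "L i' j \<noteq> s" if "i' \<in> {1..k} - {i}" for i'
      using latin_rectangles_column[OF L(2), of j i' i] that i j L(3) by auto
    then show "L \<in> B" using L(1) by (simp add: B_def)
  qed
  have cB: "card B = (\<Sum>y\<in>r ` B. card {L \<in> B. r L = y})"
    using sum.image_gen[OF finB, of "\<lambda>_. 1::nat" r] by simp
  have cX: "card X = (\<Sum>y\<in>r ` B. card {L \<in> X. r L = y})"
    using sum.group[OF finX, of "r ` B" r "\<lambda>_. 1::nat"] finB image_mono[OF XB, of r] by simp
  have fiber: "real lo * real (card {L \<in> X. r L = y}) \<le> \<rho> * real (card {L \<in> B. r L = y}) \<and>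
      real (card {L \<in> B. r L = y}) \<le> \<rho> * real hi * real (card {L \<in> X. r L = y})"
    if "y \<in> r ` B" for y
  proof -
    obtain L1 where L1: "L1 \<in> B" "y = r L1" using \<open>y \<in> r ` B\<close> by auto
    then have L1A: "L1 \<in> completions k n D F" and L1R: "L1 \<in> latin_rectangles k n"
      by (auto simp: B_def A_def completions_def)
    define E where "E = allowed k D F i L1"
    define M where "M = matchings E {1..n} {1..n}"
    have bij: "bij_betw (\<lambda>f. L1(i := f)) M {L \<in> A. r L = y}"
      using bij_betw_row_completions[OF L1A i] by (simp add: M_def E_def A_def r_def L1)
    have "{L \<in> B. r L = y} = {L \<in> A. r L = y}"
    proof -
      have "L \<in> B" if "L \<in> A" "r L = y" for L
      proof -
        have eq: "L(i := undefined) = L1(i := undefined)" using that L1 by (simp add: r_def)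
        have "L i' = L1 i'" if "i' \<noteq> i" for i' using fun_cong[OF eq, of i'] that by simp
        then show ?thesis using \<open>L \<in> A\<close> L1(1) by (auto simp: B_def)
      qed
      then show ?thesis by (auto simp: B_def)
    qed
    then have fB: "card {L \<in> B. r L = y} = num_matchings E {1..n} {1..n}"
      using bij_betw_same_card[OF bij] by (simp add: num_matchings_def M_def)
    have "{L \<in> X. r L = y} = {L \<in> {L \<in> A. r L = y}. L i j = s}" by (auto simp: X_def)
    also have "\<dots> = (\<lambda>f. L1(i := f)) ` {f \<in> M. f j = s}"
      unfolding bij_betw_imp_surj_on[OF bij, symmetric] by auto
    finally have "card {L \<in> X. r L = y} = card {f \<in> M. f j = s}"
      using bij by (simp, intro card_image) (auto simp: bij_betw_def intro: inj_on_subset)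
    also have Ejs: "E j s" using j L1 by (auto simp: E_def allowed_def B_def K_def)
    then have "card {f \<in> M. f j = s} = num_matchings E ({1..n} - {j}) ({1..n} - {s})"
      unfolding M_def using j s by (intro card_matchings_through) auto
    also have forced: "E j' t \<longleftrightarrow> t = F i j'" if "j' \<in> K" for j' t
      using that by (auto simp: E_def allowed_def K_def)
    have "num_matchings E ({1..n} - {j}) ({1..n} - {s}) = num_matchings E ({1..n} - {j} - K) ({1..n} - {s} - F i ` K)"
      using K j s finK forced by (intro num_matchings_forced) auto
    also have "\<dots> = num_matchings E ({1..n} - K - {j}) ({1..n} - F i ` K - {s})"
      by (intro arg_cong2[where f = "num_matchings E"]) auto
    finally have fX: "card {L \<in> X. r L = y} = num_matchings E ({1..n} - K - {j}) ({1..n} - F i ` K - {s})" .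
    have fB': "num_matchings E {1..n} {1..n} = num_matchings E ({1..n} - K) ({1..n} - F i ` K)"
      using K finK forced by (intro num_matchings_forced) auto
    have "near_regular E ({1..n} - K) ({1..n} - F i ` K) lo hi"
      unfolding lo_def hi_def E_def using near_regular_allowed[OF L1R i kn, of D m F] K(1,2)
      unfolding K_def by simp
    moreover have "card ({1..n} - K) = card ({1..n} - F i ` K)"
      using K finK by (simp add: card_Diff_subset card_image)
    moreover have "card ({1..n} - F i ` K) \<le> n"
      using card_mono[of "{1..n}" "{1..n} - F i ` K"] by auto
    ultimately have "uniform_edges \<rho> lo hi E ({1..n} - K) ({1..n} - F i ` K)" by (rule UE)
    then show ?thesis unfolding fX fB fB' uniform_edges_def using j s Ejs by blast
  qed
  show "real lo * real (card X) \<le> \<rho> * real (card B)"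
    unfolding cB cX of_nat_sum sum_distrib_left by (intro sum_mono) (use fiber in auto)
  show "real (card B) \<le> \<rho> * real hi * real (card X)"
    unfolding cB cX of_nat_sum sum_distrib_left by (intro sum_mono) (use fiber in auto)
qed

section \<open>Extending a partial pattern by one cell\<close>

text \<open>
  Here \<open>x i'\<close> stands for the number of rectangles with the symbol \<open>s\<close> in row \<open>i'\<close> of a fixed column,
  and \<open>z\<close> for the number of rectangles in which this column does not contain \<open>s\<close>. The hypotheses say that
  every \<open>x i'\<close> is about \<open>z / (n - k)\<close>, except for the few rows in \<open>R\<close> other than \<open>i\<close>,
  for which only the upper bound is known. Hence the total is about \<open>z * (1 + k / (n - k)) = z * n / (n - k)\<close>, so that
  \<open>x i\<close> is a proportion of about \<open>1 / n\<close> of it: the unknown \<open>z\<close> cancels.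
\<close>

lemma self_consistent_estimate:
  fixes x :: "'a \<Rightarrow> real" and z \<rho> lo hi n k m :: real
  assumes fin: "finite I" "real (card I) = k" "R \<subseteq> I" "real (card R) = m" "i \<in> I"
    and z: "0 \<le> z" and x: "\<And>i'. i' \<in> I \<Longrightarrow> 0 \<le> x i'"
    and up: "\<And>i'. i' \<in> I \<Longrightarrow> lo * x i' \<le> \<rho> * (z + x i')"
    and low: "\<And>i'. i' \<in> I \<Longrightarrow> i' \<notin> R \<or> i' = i \<Longrightarrow> z + x i' \<le> \<rho> * hi * x i'"
    and \<rho>: "1 \<le> \<rho>" "\<rho> < lo" and hi: "hi = n - k + 1" and lo: "lo = hi - m"
  shows "(lo - \<rho>) / (hi * \<rho>\<^sup>2 * n) * (z + (\<Sum>i'\<in>I. x i')) \<le> x i"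
    and "x i \<le> \<rho>\<^sup>2 * hi / ((lo - \<rho>) * (n + 1 - m)) * (z + (\<Sum>i'\<in>I. x i'))"
proof -
  have finR: "finite R" using fin(1,3) finite_subset by blast
  have m0: "0 \<le> m" using fin(4) by auto
  have km: "0 \<le> k - m" using card_mono[OF fin(1,3)] fin(2,4) by linarith
  have pos: "0 < lo - \<rho>" "0 < hi" "0 < \<rho>" using \<rho> lo m0 by linarith+
  have n0: "0 < n + 1 - m" "0 < n" using pos hi lo km m0 \<rho> by linarith+
  define u where "u = \<rho> / (lo - \<rho>)"
  define l where "l = 1 / (\<rho> * hi)"
  have u0: "0 \<le> u" and l0: "0 \<le> l" using pos by (auto simp: u_def l_def)
  have xu: "x i' \<le> u * z" if "i' \<in> I" for i'
  proof -
    have "(lo - \<rho>) * x i' \<le> \<rho> * z" using up[OF that] by (simp add: algebra_simps)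
    then show ?thesis using pos by (simp add: u_def field_simps)
  qed
  have xl: "l * z \<le> x i'" if "i' \<in> I" "i' \<notin> R \<or> i' = i" for i'
  proof -
    have "z \<le> \<rho> * hi * x i'" using low[OF that] x[OF that(1)] by linarith
    then show ?thesis using pos by (simp add: l_def field_simps)
  qed
  have "(\<Sum>i'\<in>I. x i') \<le> real (card I) * (u * z)" using xu by (intro sum_bounded_above) auto
  then have tot_up: "z + (\<Sum>i'\<in>I. x i') \<le> (1 + k * u) * z" using fin by (simp add: algebra_simps)
  have "real (card (I - R)) * (l * z) \<le> (\<Sum>i'\<in>I - R. x i')"
    using xl by (intro sum_bounded_below) auto
  also have "\<dots> \<le> (\<Sum>i'\<in>I. x i')" using x fin by (intro sum_mono2) auto
  finally have "real (card (I - R)) * (l * z) \<le> (\<Sum>i'\<in>I. x i')" .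
  moreover have "real (card (I - R)) = k - m"
    using fin finR card_mono[OF fin(1,3)] by (simp add: card_Diff_subset of_nat_diff)
  ultimately have tot_low: "(1 + (k - m) * l) * z \<le> z + (\<Sum>i'\<in>I. x i')"
    by (simp add: algebra_simps)
  define c where "c = (lo - \<rho>) / (hi * \<rho>\<^sup>2 * n)"
  have c0: "0 \<le> c" using pos n0 by (simp add: c_def)
  have lou: "(lo - \<rho>) * u = \<rho>" and hil: "\<rho> * hi * l = 1" using pos by (auto simp: u_def l_def)
  have "(lo - \<rho>) * (1 + k * u) = (lo - \<rho>) + k * ((lo - \<rho>) * u)" by (simp add: algebra_simps)
  then have "c * (1 + k * u) = (lo - \<rho> + k * \<rho>) / (hi * \<rho>\<^sup>2 * n)"
    unfolding lou by (simp add: c_def)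
  also have "\<dots> \<le> (\<rho> * n) / (hi * \<rho>\<^sup>2 * n)"
  proof (rule divide_right_mono)
    have "1 * lo \<le> \<rho> * lo" using pos \<rho> by (intro mult_right_mono) auto
    then have "lo - \<rho> + k * \<rho> \<le> \<rho> * (lo - 1 + k)" by (simp add: algebra_simps)
    also have "\<dots> \<le> \<rho> * n" using pos lo hi m0 by (intro mult_left_mono) auto
    finally show "lo - \<rho> + k * \<rho> \<le> \<rho> * n" .
  qed (use pos n0 in auto)
  also have "\<dots> = l" using pos n0 by (simp add: l_def power2_eq_square)
  finally have cl: "c * (1 + k * u) \<le> l" .
  have "c * (z + (\<Sum>i'\<in>I. x i')) \<le> c * ((1 + k * u) * z)" using tot_up c0 by (rule mult_left_mono)
  also have "\<dots> = c * (1 + k * u) * z" by simp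
  also have "\<dots> \<le> l * z" using cl z by (rule mult_right_mono)
  also have "\<dots> \<le> x i" using xl fin by auto
  finally show "(lo - \<rho>) / (hi * \<rho>\<^sup>2 * n) * (z + (\<Sum>i'\<in>I. x i')) \<le> x i" by (simp add: c_def)
  define d where "d = \<rho>\<^sup>2 * hi / ((lo - \<rho>) * (n + 1 - m))"
  have d0: "0 \<le> d" using pos n0 by (simp add: d_def)
  have "u = u * (n + 1 - m) / (n + 1 - m)" using n0 by simp
  also have "\<dots> \<le> u * (\<rho> * hi + k - m) / (n + 1 - m)"
  proof (intro divide_right_mono mult_left_mono)
    have "1 * hi \<le> \<rho> * hi" using pos \<rho> by (intro mult_right_mono) auto
    then show "n + 1 - m \<le> \<rho> * hi + k - m" using hi by simp
  qed (use u0 n0 in auto)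
  also have "\<rho> * hi + k - m = \<rho> * hi * (1 + (k - m) * l)"
  proof -
    have "\<rho> * hi * (1 + (k - m) * l) = \<rho> * hi + (k - m) * (\<rho> * hi * l)" by (simp add: algebra_simps)
    then show ?thesis unfolding hil by simp
  qed
  also have "u * (\<rho> * hi * (1 + (k - m) * l)) / (n + 1 - m) = d * (1 + (k - m) * l)"
    by (simp add: d_def u_def power2_eq_square)
  finally have ud: "u \<le> d * (1 + (k - m) * l)" .
  have "x i \<le> u * z" using xu fin by auto
  also have "\<dots> \<le> d * (1 + (k - m) * l) * z" using ud z by (rule mult_right_mono)
  also have "\<dots> = d * ((1 + (k - m) * l) * z)" by simp
  also have "\<dots> \<le> d * (z + (\<Sum>i'\<in>I. x i'))" using tot_low d0 by (rule mult_left_mono)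
  finally show "x i \<le> \<rho>\<^sup>2 * hi / ((lo - \<rho>) * (n + 1 - m)) * (z + (\<Sum>i'\<in>I. x i'))" by (simp add: d_def)
qed

text \<open>
  This is what the part on matchings provides about resampling a row of a \<open>k \<times> n\<close> rectangle in
  which at most \<open>m\<close> cells of that row are prescribed.
\<close>

definition uniform_rows :: "real \<Rightarrow> nat \<Rightarrow> nat \<Rightarrow> nat \<Rightarrow> bool" where
  "uniform_rows \<rho> n k m \<longleftrightarrow> (\<forall>E (J :: nat set) (S :: nat set).
     near_regular E J S (n - k + 1 - m) (n - k + 1) \<longrightarrow> card J = card S \<longrightarrow> card S \<le> n \<longrightarrow>
     uniform_edges \<rho> (n - k + 1 - m) (n - k + 1) E J S)"

text \<open>
  Given that a random rectangle follows the pattern \<open>F\<close> on the cells in \<open>D\<close>, it also does so at one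
  further cell \<open>(i, j)\<close> with probability about \<open>1 / n\<close>. For each row \<open>i'\<close> in which \<open>s = F i j\<close> can
  appear in column \<open>j\<close>, resampling that row compares the number of rectangles in which it does with
  the number of those in which no other row has \<open>s\<close> in this column; \<open>self_consistent_estimate\<close>
  then applies. The rows in which \<open>s\<close> is excluded all lie in \<open>R\<close>.
\<close>

lemma card_completions_insert:
  assumes kn: "k \<le> n" and R: "R \<subseteq> {1..k}" "card R = m" and C: "C \<subseteq> {1..n}" "card C = m"
    and S: "S \<subseteq> {1..n}" and F: "latin_square_on R C S F"
    and D: "D \<subseteq> R \<times> C" and ij: "(i, j) \<in> R \<times> C - D"
    and UR: "uniform_rows \<rho> n k m"
    and \<rho>: "1 \<le> \<rho>" "\<rho> < real n - real k + 1 - real m"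
  defines "hi \<equiv> real n - real k + 1"
  defines "lo \<equiv> hi - real m"
  shows "(lo - \<rho>) / (hi * \<rho>\<^sup>2 * real n) * real (card (completions k n D F))
           \<le> real (card (completions k n (insert (i, j) D) F))"
    and "real (card (completions k n (insert (i, j) D) F))
           \<le> \<rho>\<^sup>2 * hi / ((lo - \<rho>) * (real n + 1 - real m)) * real (card (completions k n D F))"
proof -
  define s where "s = F i j"
  define A where "A = completions k n D F"
  define X where "X i' = {L \<in> A. L i' j = s}" for i'
  define Z where "Z = {L \<in> A. \<forall>i'\<in>{1..k}. L i' j \<noteq> s}"
  have i: "i \<in> {1..k}" "i \<in> R" and j: "j \<in> C" "j \<in> {1..n}" using ij R C by auto
  have rowF: "bij_betw (F i') C S" if "i' \<in> R" for i' using F that by (simp add: latin_square_on_def)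
  have colF: "bij_betw (\<lambda>i. F i j') R S" if "j' \<in> C" for j'
    using F that by (simp add: latin_square_on_def)
  have s: "s \<in> S" "s \<in> {1..n}" using rowF[OF i(2)] j S by (auto simp: s_def bij_betw_def)
  have finA: "finite A" unfolding A_def by (rule finite_completions)
  then have finX: "finite (X i')" and finZ: "finite Z" for i' by (auto simp: X_def Z_def)
  have once: "i' = i''" if "L \<in> A" "i' \<in> {1..k}" "i'' \<in> {1..k}" "L i' j = s" "L i'' j = s" for L i' i''
  proof (rule latin_rectangles_column[OF _ j(2) that(2,3)])
    show "L \<in> latin_rectangles k n" using that(1) by (simp add: A_def completions_def)
    show "L i' j = L i'' j" by (simp only: that(4,5))
  qed
  have A_eq: "A = Z \<union> (\<Union>i'\<in>{1..k}. X i')" by (auto simp: Z_def X_def)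
  have "card A = card Z + card (\<Union>i'\<in>{1..k}. X i')"
    unfolding A_eq using finZ finX by (intro card_Un_disjoint) (auto simp: Z_def X_def)
  also have "card (\<Union>i'\<in>{1..k}. X i') = (\<Sum>i'\<in>{1..k}. card (X i'))"
  proof (rule card_UN_disjoint)
    show "\<forall>i'\<in>{1..k}. \<forall>i''\<in>{1..k}. i' \<noteq> i'' \<longrightarrow> X i' \<inter> X i'' = {}"
      using once unfolding X_def by blast
  qed (use finX in auto)
  finally have cA: "real (card A) = real (card Z) + (\<Sum>i'\<in>{1..k}. real (card (X i')))" by simp
  have cB: "card {L \<in> A. \<forall>i''\<in>{1..k} - {i'}. L i'' j \<noteq> s} = card Z + card (X i')"
    if i': "i' \<in> {1..k}" for i'
  proof -
    have "{L \<in> A. \<forall>i''\<in>{1..k} - {i'}. L i'' j \<noteq> s} = Z \<union> X i'"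
    proof (intro equalityI subsetI)
      fix L assume "L \<in> Z \<union> X i'"
      then show "L \<in> {L \<in> A. \<forall>i''\<in>{1..k} - {i'}. L i'' j \<noteq> s}"
        using once[of L i'] i' unfolding Z_def X_def by blast
    qed (auto simp: Z_def X_def)
    then show ?thesis using finZ finX i' by (simp add: card_Un_disjoint Z_def X_def disjoint_iff)
  qed
  define K where "K i' = {j'. (i', j') \<in> D}" for i'
  have KC: "K i' \<subseteq> C" for i' using D by (auto simp: K_def)
  have finC: "finite C" using C(1) finite_subset by blast
  have KR: "i' \<in> R" if "K i' \<noteq> {}" for i' using that D by (auto simp: K_def)
  have K: "K i' \<subseteq> {1..n}" "card (K i') \<le> m" "inj_on (F i') (K i')" "F i' ` K i' \<subseteq> {1..n}" for i'
  proof -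
    show "K i' \<subseteq> {1..n}" using KC C by blast
    show "card (K i') \<le> m" using card_mono[OF finC KC] C by simp
    show "inj_on (F i') (K i')"
      using KR[of i'] rowF[of i'] inj_on_subset[OF _ KC[of i']] by (cases "K i' = {}") (auto simp: bij_betw_def)
    show "F i' ` K i' \<subseteq> {1..n}"
      using KR[of i'] rowF[of i'] KC[of i'] S by (cases "K i' = {}") (auto simp: bij_betw_def)
  qed
  have deg: "real (n - k + 1) = hi" "real (n - k + 1 - m) = lo"
    using kn \<rho> by (auto simp: hi_def lo_def of_nat_diff)
  have free: "lo * real (card (X i')) \<le> \<rho> * (real (card Z) + real (card (X i')))"
    "real (card Z) + real (card (X i')) \<le> \<rho> * hi * real (card (X i'))"
    if "i' \<in> {1..k}" "j \<notin> K i'" "s \<notin> F i' ` K i'" for i'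
  proof -
    note rr = row_resample[where D = D and F = F and m = m and \<rho> = \<rho> and j = j and s = s,
        OF that(1) kn K[of i', unfolded K_def]]
    have UE: "\<And>E (J::nat set) (S::nat set). near_regular E J S (n - k + 1 - m) (n - k + 1)
        \<Longrightarrow> card J = card S \<Longrightarrow> card S \<le> n \<Longrightarrow> uniform_edges \<rho> (n - k + 1 - m) (n - k + 1) E J S"
      using UR unfolding uniform_rows_def by blast
    have pre: "j \<in> {1..n} - {j. (i', j) \<in> D}" "s \<in> {1..n} - F i' ` {j. (i', j) \<in> D}"
      using that j s by (auto simp: K_def)
    show "lo * real (card (X i')) \<le> \<rho> * (real (card Z) + real (card (X i')))"
      using rr(1)[OF pre UE, folded A_def, folded X_def, unfolded cB[OF that(1)] deg]
      by (simp only: of_nat_add)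
    show "real (card Z) + real (card (X i')) \<le> \<rho> * hi * real (card (X i'))"
      using rr(2)[OF pre UE, folded A_def, folded X_def, unfolded cB[OF that(1)] deg]
      by (simp only: of_nat_add)
  qed
  have blocked: "X i' = {}" if asm: "i' \<in> {1..k}" "j \<in> K i' \<or> s \<in> F i' ` K i'" for i'
  proof (rule ccontr)
    assume "X i' \<noteq> {}"
    then obtain L where L: "L \<in> A" "L i' j = s" by (auto simp: X_def)
    then have LD: "\<And>a b. (a, b) \<in> D \<Longrightarrow> L a b = F a b" and LR: "L \<in> latin_rectangles k n"
      by (auto simp: A_def completions_def)
    have "(i', j) \<in> D"
    proof (rule ccontr)
      assume "(i', j) \<notin> D"
      then obtain j' where j': "(i', j') \<in> D" "F i' j' = s" using asm(2) by (auto simp: K_def)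
      then have "L i' j' = L i' j" using LD L by simp
      moreover have "inj_on (L i') {1..n}"
        using latin_rectangles_row(2)[OF LR asm(1)] by (simp add: bij_betw_def)
      moreover have "j' \<in> {1..n}" using j' D C by auto
      ultimately have "j' = j" using j by (auto dest: inj_onD)
      then show False using j' \<open>(i', j) \<notin> D\<close> by simp
    qed
    then have "F i' j = F i j" "i' \<in> R" using LD L D by (auto simp: s_def)
    then have "i' = i" using colF[OF j(1)] i by (auto simp: bij_betw_def dest: inj_onD)
    then show False using \<open>(i', j) \<in> D\<close> ij by simp
  qed
  have free_i: "j \<notin> K i" "s \<notin> F i ` K i"
  proof -
    show "j \<notin> K i" using ij by (simp add: K_def)
    show "s \<notin> F i ` K i"
    proof
      assume "s \<in> F i ` K i"
      then obtain j' where "j' \<in> K i" "F i j' = F i j" by (auto simp: s_def)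
      then have "j' = j" using rowF[OF i(2)] KC[of i] j by (auto simp: bij_betw_def dest: inj_onD)
      then show False using \<open>j' \<in> K i\<close> \<open>j \<notin> K i\<close> by simp
    qed
  qed
  have ins: "completions k n (insert (i, j) D) F = X i"
    by (auto simp: completions_def X_def A_def s_def)
  note est = self_consistent_estimate[where I = "{1..k}" and R = R and i = i and n = "real n" and k = "real k"
      and m = "real m" and z = "real (card Z)" and x = "\<lambda>i'. real (card (X i'))" and lo = lo and hi = hi
      and \<rho> = \<rho>]
  have up: "lo * real (card (X i')) \<le> \<rho> * (real (card Z) + real (card (X i')))"
    if "i' \<in> {1..k}" for i'
    using free(1)[OF that] blocked[OF that] \<rho> by (cases "j \<in> K i' \<or> s \<in> F i' ` K i'") auto
  have low: "real (card Z) + real (card (X i')) \<le> \<rho> * hi * real (card (X i'))"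
    if "i' \<in> {1..k}" "i' \<notin> R \<or> i' = i" for i'
    using free(2)[OF that(1)] that(2) KR[of i'] free_i by (cases "K i' = {}") auto
  have lo: "\<rho> < lo" using \<rho> by (simp add: lo_def hi_def)
  show "(lo - \<rho>) / (hi * \<rho>\<^sup>2 * real n) * real (card (completions k n D F))
           \<le> real (card (completions k n (insert (i, j) D) F))"
    unfolding ins A_def[symmetric] cA
    by (rule est(1)) (use R i \<rho>(1) up low lo in \<open>auto simp: hi_def lo_def\<close>)
  show "real (card (completions k n (insert (i, j) D) F))
           \<le> \<rho>\<^sup>2 * hi / ((lo - \<rho>) * (real n + 1 - real m)) * real (card (completions k n D F))"
    unfolding ins A_def[symmetric] cA
    by (rule est(2)) (use R i \<rho>(1) up low lo in \<open>auto simp: hi_def lo_def\<close>)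
qed

text \<open>
  The chain rule: the cells of the pattern are prescribed one after the other, in any order.
\<close>

lemma card_completions_pattern:
  assumes kn: "k \<le> n" and R: "R \<subseteq> {1..k}" "card R = m" and C: "C \<subseteq> {1..n}" "card C = m"
    and S: "S \<subseteq> {1..n}" and F: "latin_square_on R C S F"
    and step: "\<And>D i j. D \<subseteq> R \<times> C \<Longrightarrow> (i, j) \<in> R \<times> C - D \<Longrightarrow>
        a * real (card (completions k n D F)) \<le> real (card (completions k n (insert (i, j) D) F)) \<and>
        real (card (completions k n (insert (i, j) D) F)) \<le> b * real (card (completions k n D F))"
    and ab: "0 \<le> a" "0 \<le> b"
  shows "a ^ (m\<^sup>2) * real (card (latin_rectangles k n)) \<le> real (card (completions k n (R \<times> C) F))"
    and "real (card (completions k n (R \<times> C) F)) \<le> b ^ (m\<^sup>2) * real (card (latin_rectangles k n))"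
proof -
  have fin: "finite (R \<times> C)" using R C finite_subset by (metis finite_SigmaI finite_atLeastAtMost)
  have "a ^ card D * real (card (latin_rectangles k n)) \<le> real (card (completions k n D F)) \<and>
      real (card (completions k n D F)) \<le> b ^ card D * real (card (latin_rectangles k n))"
    if "finite D" "D \<subseteq> R \<times> C" for D
    using that
  proof (induction D rule: finite_induct)
    case empty
    then show ?case by (simp add: completions_def)
  next
    case (insert c D)
    obtain i j where c: "c = (i, j)" by (cases c)
    have IH: "a ^ card D * real (card (latin_rectangles k n)) \<le> real (card (completions k n D F))"
      "real (card (completions k n D F)) \<le> b ^ card D * real (card (latin_rectangles k n))"
      using insert by auto
    have st: "a * real (card (completions k n D F)) \<le> real (card (completions k n (insert c D) F))"
      "real (card (completions k n (insert c D) F)) \<le> b * real (card (completions k n D F))"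
      using step[of D i j] insert c by auto
    have "a * (a ^ card D * real (card (latin_rectangles k n))) \<le> real (card (completions k n (insert c D) F))"
      using mult_left_mono[OF IH(1) ab(1)] st(1) by linarith
    moreover have "real (card (completions k n (insert c D) F)) \<le> b * (b ^ card D * real (card (latin_rectangles k n)))"
      using mult_left_mono[OF IH(2) ab(2)] st(2) by linarith
    ultimately show ?case using insert by (simp add: mult_ac)
  qed
  from this[OF fin subset_refl] show
    "a ^ (m\<^sup>2) * real (card (latin_rectangles k n)) \<le> real (card (completions k n (R \<times> C) F))"
    "real (card (completions k n (R \<times> C) F)) \<le> b ^ (m\<^sup>2) * real (card (latin_rectangles k n))"
    using R C by (simp_all add: card_cartesian_product power2_eq_square)
qed

section \<open>Counting pairs of a rectangle and a subsquare\<close>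

text \<open>
  Unlike in the definition of a subsquare, a pattern is extensional, so that finitely many of them
  exist and each subsquare has exactly one.
\<close>

definition patterns :: "nat set \<Rightarrow> nat set \<Rightarrow> nat set \<Rightarrow> (nat \<Rightarrow> nat \<Rightarrow> nat) set" where
  "patterns R C S = {F \<in> R \<rightarrow>\<^sub>E C \<rightarrow>\<^sub>E S. latin_square_on R C S F}"

lemma finite_patterns: "finite R \<Longrightarrow> finite C \<Longrightarrow> finite S \<Longrightarrow> finite (patterns R C S)"
  unfolding patterns_def by (rule finite_subset[of _ "R \<rightarrow>\<^sub>E C \<rightarrow>\<^sub>E S"]) (auto intro!: finite_PiE)

text \<open>
  Relabelling rows, columns and symbols maps patterns injectively to patterns. An inequality suffices,
  since it can be applied in both directions.
\<close>

lemma card_patterns_le: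
  assumes fin: "finite R" "finite C" "finite S" "finite R'" "finite C'" "finite S'"
    and eq: "card R = card R'" "card C = card C'" "card S = card S'"
  shows "card (patterns R C S) \<le> card (patterns R' C' S')"
proof -
  obtain f where f: "bij_betw f R' R" using finite_same_card_bij[OF fin(4,1)] eq by auto
  obtain g where g: "bij_betw g C' C" using finite_same_card_bij[OF fin(5,2)] eq by auto
  obtain h where h: "bij_betw h S S'" using finite_same_card_bij[OF fin(3,6)] eq by auto
  define T where "T F = (\<lambda>i\<in>R'. \<lambda>j\<in>C'. h (F (f i) (g j)))" for F :: "nat \<Rightarrow> nat \<Rightarrow> nat"
  have fR: "f i \<in> R" if "i \<in> R'" for i using f that by (rule bij_betwE[rule_format])
  have gC: "g j \<in> C" if "j \<in> C'" for j using g that by (rule bij_betwE[rule_format])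
  have FS: "F i j \<in> S" if "F \<in> patterns R C S" "i \<in> R" "j \<in> C" for F i j
    using that by (auto simp: patterns_def dest: PiE_mem)
  have "inj_on T (patterns R C S)"
  proof (rule inj_onI)
    fix F G assume F: "F \<in> patterns R C S" and G: "G \<in> patterns R C S" and TFG: "T F = T G"
    have same: "F i j = G i j" if i: "i \<in> R" and j: "j \<in> C" for i j
    proof -
      obtain i' j' where i': "i' \<in> R'" "f i' = i" and j': "j' \<in> C'" "g j' = j"
        using f g i j unfolding bij_betw_def by blast
      have "T F i' j' = T G i' j'" using TFG by simp
      then have "h (F i j) = h (G i j)" using i' j' by (simp add: T_def)
      then show ?thesis using h FS[OF F i j] FS[OF G i j] unfolding bij_betw_def by (meson inj_onD)
    qed
    show "F = G"
    proof (rule PiE_ext)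
      show "F \<in> R \<rightarrow>\<^sub>E C \<rightarrow>\<^sub>E S" "G \<in> R \<rightarrow>\<^sub>E C \<rightarrow>\<^sub>E S" using F G by (auto simp: patterns_def)
      fix i assume i: "i \<in> R"
      show "F i = G i"
      proof (rule PiE_ext)
        show "F i \<in> C \<rightarrow>\<^sub>E S" "G i \<in> C \<rightarrow>\<^sub>E S" using F G i by (auto simp: patterns_def dest: PiE_mem)
      qed (rule same[OF i])
    qed
  qed
  moreover have "T ` patterns R C S \<subseteq> patterns R' C' S'"
  proof
    fix M assume "M \<in> T ` patterns R C S"
    then obtain F where F: "F \<in> patterns R C S" "M = T F" by blast
    then have L: "latin_square_on R C S F" by (simp add: patterns_def)
    have row: "bij_betw (T F i) C' S'" if i: "i \<in> R'" for i
    proof -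
      have "bij_betw (F (f i)) C S" using L fR[OF i] by (simp add: latin_square_on_def)
      then have "bij_betw (h \<circ> (F (f i) \<circ> g)) C' S'" using g h by (intro bij_betw_trans)
      then show ?thesis by (subst bij_betw_cong) (use i in \<open>auto simp: T_def\<close>)
    qed
    have col: "bij_betw (\<lambda>i. T F i j) R' S'" if j: "j \<in> C'" for j
    proof -
      have "bij_betw (\<lambda>i. F i (g j)) R S" using L gC[OF j] by (simp add: latin_square_on_def)
      then have "bij_betw (h \<circ> ((\<lambda>i. F i (g j)) \<circ> f)) R' S'" using f h by (intro bij_betw_trans)
      then show ?thesis by (subst bij_betw_cong) (use j in \<open>auto simp: T_def\<close>)
    qed
    have "T F \<in> R' \<rightarrow>\<^sub>E C' \<rightarrow>\<^sub>E S'"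
    proof (rule PiE_I)
      fix i assume i: "i \<in> R'"
      show "T F i \<in> C' \<rightarrow>\<^sub>E S'"
        using bij_betwE[OF row[OF i]] i by (intro PiE_I) (auto simp: T_def)
    qed (auto simp: T_def)
    then show "M \<in> patterns R' C' S'"
      using row col F by (simp add: patterns_def latin_square_on_def)
  qed
  ultimately show ?thesis using finite_patterns[OF fin(4-6)] by (rule card_inj_on_le)
qed

lemma card_patterns:
  assumes "finite R" "finite C" "finite S" "card R = m" "card C = m" "card S = m"
  shows "card (patterns R C S) = card (latin_squares m)"
proof -
  have "latin_squares m = patterns {1..m} {1..m} {1..m}"
    by (simp add: latin_squares_def patterns_def)
  then show ?thesis
    using card_patterns_le[of R C S "{1..m}" "{1..m}" "{1..m}"]
      card_patterns_le[of "{1..m}" "{1..m}" "{1..m}" R C S] assms by simp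
qed

text \<open>
  All possible contents of a subsquare: its rows, columns and symbols together with the Latin square
  that is placed there.
\<close>

definition placements :: "nat \<Rightarrow> nat \<Rightarrow> nat \<Rightarrow> ((nat set \<times> nat set \<times> nat set) \<times> (nat \<Rightarrow> nat \<Rightarrow> nat)) set" where
  "placements k n m =
     (SIGMA (R, C, S) : {R. R \<subseteq> {1..k} \<and> card R = m} \<times>
        {C. C \<subseteq> {1..n} \<and> card C = m} \<times> {S. S \<subseteq> {1..n} \<and> card S = m}. patterns R C S)"

lemma finite_if_subset_interval: "A \<subseteq> {Suc 0..n} \<Longrightarrow> finite A"
  by (rule finite_subset[OF _ finite_atLeastAtMost])

lemma finite_placements: "finite (placements k n m)"
  unfolding placements_def
  by (intro finite_SigmaI finite_cartesian_product)
    (auto intro!: finite_patterns intro: finite_if_subset_interval)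

lemma card_placements:
  "card (placements k n m) = (n choose m)\<^sup>2 * (k choose m) * card (latin_squares m)"
proof -
  have "card (placements k n m) =
      (\<Sum>(R, C, S)\<in>{R. R \<subseteq> {1..k} \<and> card R = m} \<times>
        {C. C \<subseteq> {1..n} \<and> card C = m} \<times> {S. S \<subseteq> {1..n} \<and> card S = m}. card (patterns R C S))"
    unfolding placements_def
    by (subst card_SigmaI)
      (auto intro!: finite_patterns sum.cong intro: finite_if_subset_interval)
  also have "\<dots> = (\<Sum>(R, C, S)\<in>{R. R \<subseteq> {1..k} \<and> card R = m} \<times>
        {C. C \<subseteq> {1..n} \<and> card C = m} \<times> {S. S \<subseteq> {1..n} \<and> card S = m}. card (latin_squares m))"
    by (intro sum.cong refl)
      (auto intro!: card_patterns intro: finite_if_subset_interval)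
  also have "\<dots> = (n choose m)\<^sup>2 * (k choose m) * card (latin_squares m)"
    by (simp add: card_cartesian_product n_subsets power2_eq_square case_prod_unfold)
  finally show ?thesis .
qed

text \<open>
  The symbol set and the pattern of a subsquare are determined by its rows and columns, as \<open>m \<ge> 1\<close>
  makes the set of rows nonempty. A symbol set of a subsquare consists of entries of \<open>L\<close>, which
  is why only subsets of \<open>{1..n}\<close> have to be considered.
\<close>

lemma SS_eq_card_placements:
  assumes L: "L \<in> latin_rectangles k n" and m: "1 \<le> m"
  shows "SS k n m L = card {((R, C, S), F) \<in> placements k n m. L \<in> completions k n (R \<times> C) F}"
    (is "_ = card ?Q")
proof -
  let ?p = "\<lambda>((R, C, S), F). (R, C) :: nat set \<times> nat set"
  have agree: "latin_square_on R C S L" "F = (\<lambda>i\<in>R. \<lambda>j\<in>C. L i j)"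
    if "((R, C, S), F) \<in> ?Q" for R C S F
  proof -
    have F: "F \<in> R \<rightarrow>\<^sub>E C \<rightarrow>\<^sub>E S" "latin_square_on R C S F"
      and LF: "\<And>i j. i \<in> R \<Longrightarrow> j \<in> C \<Longrightarrow> L i j = F i j"
      using that by (auto simp: placements_def patterns_def completions_def)
    have "bij_betw (L i) C S" if "i \<in> R" for i
      using F(2) that LF by (subst bij_betw_cong[where g = "F i"]) (auto simp: latin_square_on_def)
    moreover have "bij_betw (\<lambda>i. L i j) R S" if "j \<in> C" for j
      using F(2) that LF
      by (subst bij_betw_cong[where g = "\<lambda>i. F i j"]) (auto simp: latin_square_on_def)
    ultimately show "latin_square_on R C S L" by (simp add: latin_square_on_def)
    show "F = (\<lambda>i\<in>R. \<lambda>j\<in>C. L i j)"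
    proof
      fix i
      show "F i = (\<lambda>i\<in>R. \<lambda>j\<in>C. L i j) i"
      proof (cases "i \<in> R")
        case True
        then have "F i \<in> C \<rightarrow>\<^sub>E S" using F(1) by auto
        then show ?thesis using True LF by (auto simp: fun_eq_iff PiE_def extensional_def)
      next
        case False
        then show ?thesis using F(1) by (auto simp: PiE_def extensional_def)
      qed
    qed
  qed
  have nonempty: "\<exists>i. i \<in> R" if "card R = m" for R :: "nat set"
    using that m by (metis all_not_in_conv card.empty not_one_le_zero)
  have "inj_on ?p ?Q"
  proof (rule inj_onI)
    fix x y assume x: "x \<in> ?Q" and y: "y \<in> ?Q" and xy: "?p x = ?p y"
    obtain R C S F where xe: "x = ((R, C, S), F)" by (metis surj_pair)
    obtain R' C' S' F' where ye: "y = ((R', C', S'), F')" by (metis surj_pair)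
    have eq: "R' = R" "C' = C" using xy by (auto simp: xe ye)
    have "card R = m" using x by (auto simp: xe placements_def)
    then obtain i where i: "i \<in> R" using nonempty by blast
    have "S = L i ` C" "S' = L i ` C"
      using agree(1)[OF x[unfolded xe]] agree(1)[OF y[unfolded ye]] i
      by (auto simp: latin_square_on_def bij_betw_def eq)
    moreover have "F = F'"
      using agree(2)[OF x[unfolded xe]] agree(2)[OF y[unfolded ye]] by (simp add: eq)
    ultimately show "x = y" by (simp add: xe ye eq)
  qed
  moreover have "?p ` ?Q = latin_subsquares k n m L"
  proof (intro equalityI subsetI)
    fix z assume "z \<in> ?p ` ?Q"
    then obtain R C S F where q: "((R, C, S), F) \<in> ?Q" and z: "z = (R, C)" by auto
    show "z \<in> latin_subsquares k n m L"
      using q agree(1)[OF q] unfolding z latin_subsquares_def placements_def by auto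
  next
    fix z assume "z \<in> latin_subsquares k n m L"
    then obtain R C S where z: "z = (R, C)" and RC: "R \<subseteq> {1..k}" "C \<subseteq> {1..n}" "card R = m" "card C = m"
      and S: "card S = m" "latin_square_on R C S L" by (auto simp: latin_subsquares_def)
    obtain i where i: "i \<in> R" using nonempty RC by blast
    have "S = L i ` C" using S i by (auto simp: latin_square_on_def bij_betw_def)
    moreover have "L i \<in> {1..n} \<rightarrow>\<^sub>E {1..n}" using latin_rectangles_row(1)[OF L] RC i by blast
    ultimately have Sn: "S \<subseteq> {1..n}" using RC by auto
    define F where "F = (\<lambda>i\<in>R. \<lambda>j\<in>C. L i j)"
    have row: "bij_betw (F i) C S" if "i \<in> R" for i
      using S(2) that by (subst bij_betw_cong[where g = "L i"]) (auto simp: latin_square_on_def F_def)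
    have col: "bij_betw (\<lambda>i. F i j) R S" if "j \<in> C" for j
      using S(2) that
      by (subst bij_betw_cong[where g = "\<lambda>i. L i j"]) (auto simp: latin_square_on_def F_def)
    have "F \<in> R \<rightarrow>\<^sub>E C \<rightarrow>\<^sub>E S"
    proof (rule PiE_I)
      fix i assume i: "i \<in> R"
      show "F i \<in> C \<rightarrow>\<^sub>E S" using bij_betwE[OF row[OF i]] i by (intro PiE_I) (auto simp: F_def)
    qed (auto simp: F_def)
    then have "F \<in> patterns R C S" using row col by (simp add: patterns_def latin_square_on_def)
    moreover have "L \<in> completions k n (R \<times> C) F" using L by (auto simp: completions_def F_def)
    ultimately have "((R, C, S), F) \<in> ?Q" using RC S(1) Sn by (auto simp: placements_def)
    then show "z \<in> ?p ` ?Q" unfolding z by force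
  qed
  ultimately show ?thesis unfolding SS_def using card_image[of ?p ?Q] by simp
qed

text \<open>
  The uniform distribution on the rectangles is meaningful because cyclic shifts give one.
\<close>

lemma latin_rectangles_nonempty:
  assumes "k \<le> n"
  shows "latin_rectangles k n \<noteq> {}"
proof -
  define L where "L = (\<lambda>i\<in>{1..k}. \<lambda>j\<in>{1..n}. (i + j) mod n + 1)"
  have shift: "(c + a) mod n \<noteq> (c + b) mod n" if "a \<in> {1..n}" "b \<in> {1..n}" "a < b" for a b c :: nat
  proof
    assume "(c + a) mod n = (c + b) mod n"
    then have "n dvd (c + b) - (c + a)" using that(3) by (subst mod_eq_dvd_iff_nat[symmetric]) auto
    then have "n \<le> b - a" using that(3) by (auto dest: dvd_imp_le)
    then show False using that by auto
  qed
  have cancel: "a = b" if "a \<in> {1..n}" "b \<in> {1..n}" "(c + a) mod n = (c + b) mod n" for a b c :: nat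
    using shift[OF that(1,2), of c] shift[OF that(2,1), of c] that(3) by (metis linorder_neqE_nat)
  have range: "L i j \<in> {1..n}" if "i \<in> {1..k}" "j \<in> {1..n}" for i j
    using that by (auto simp: L_def Suc_le_eq)
  have inj: "inj_on (L i) {1..n}" if "i \<in> {1..k}" for i
  proof (rule inj_onI)
    fix j j' assume j: "j \<in> {1..n}" "j' \<in> {1..n}" "L i j = L i j'"
    then have "(i + j) mod n = (i + j') mod n" using that by (simp add: L_def)
    then show "j = j'" by (rule cancel[OF j(1,2)])
  qed
  have "L \<in> latin_rectangles k n"
    unfolding latin_rectangles_def
  proof (intro CollectI conjI ballI)
    show "L \<in> {1..k} \<rightarrow>\<^sub>E {1..n} \<rightarrow>\<^sub>E {1..n}"
    proof (rule PiE_I)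
      fix i assume i: "i \<in> {1..k}"
      show "L i \<in> {1..n} \<rightarrow>\<^sub>E {1..n}" using range[OF i] i by (intro PiE_I) (auto simp: L_def)
    qed (auto simp: L_def)
    show "bij_betw (L i) {1..n} {1..n}" if i: "i \<in> {1..k}" for i
      unfolding bij_betw_def
    proof
      show "L i ` {1..n} = {1..n}"
        using range[OF i] inj[OF i] by (intro endo_inj_surj) auto
    qed (rule inj[OF i])
    show "inj_on (\<lambda>i. L i j) {1..k}" if j: "j \<in> {1..n}" for j
    proof (rule inj_onI)
      fix i i' assume i: "i \<in> {1..k}" "i' \<in> {1..k}" "L i j = L i' j"
      then have "(j + i) mod n = (j + i') mod n" using j by (simp add: L_def add.commute)
      moreover have "i \<in> {1..n}" "i' \<in> {1..n}" using i assms by auto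
      ultimately show "i = i'" by (metis cancel)
    qed
  qed
  then show ?thesis by blast
qed

text \<open>
  Double counting of the pairs of a rectangle and a placement that it contains.
\<close>

lemma expectation_SS_bounds:
  assumes kn: "k \<le> n" and m: "1 \<le> m"
    and step: "\<And>R C S F. R \<subseteq> {1..k} \<Longrightarrow> card R = m \<Longrightarrow> C \<subseteq> {1..n} \<Longrightarrow> card C = m \<Longrightarrow> S \<subseteq> {1..n}
        \<Longrightarrow> latin_square_on R C S F \<Longrightarrow>
        a * real (card (latin_rectangles k n)) \<le> real (card (completions k n (R \<times> C) F)) \<and>
        real (card (completions k n (R \<times> C) F)) \<le> b * real (card (latin_rectangles k n))"
  defines "\<mu> \<equiv> measure_pmf.expectation (pmf_of_set (latin_rectangles k n)) (\<lambda>L. real (SS k n m L))"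
  shows "real (card (placements k n m)) * a \<le> \<mu>" and "\<mu> \<le> real (card (placements k n m)) * b"
proof -
  let ?P = "\<lambda>L ((R, C, S), F). L \<in> completions k n (R \<times> C) F"
  let ?Q = "placements k n m"
  let ?LR = "latin_rectangles k n"
  have fin: "finite ?Q" "finite ?LR" by (rule finite_placements, rule finite_latin_rectangles)
  have ne: "?LR \<noteq> {}" using kn by (rule latin_rectangles_nonempty)
  then have T: "0 < real (card ?LR)" using fin by (simp add: card_gt_0_iff)
  have "\<mu> = (\<Sum>L\<in>?LR. real (SS k n m L)) / real (card ?LR)"
    unfolding \<mu>_def using ne fin by (intro integral_pmf_of_set)
  also have "(\<Sum>L\<in>?LR. real (SS k n m L)) = (\<Sum>L\<in>?LR. \<Sum>q\<in>?Q. if ?P L q then 1 else 0)"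
  proof (intro sum.cong refl)
    fix L assume "L \<in> ?LR"
    have "{((R, C, S), F) \<in> ?Q. L \<in> completions k n (R \<times> C) F} = {q \<in> ?Q. ?P L q}" by auto
    then show "real (SS k n m L) = (\<Sum>q\<in>?Q. if ?P L q then 1 else 0)"
      using SS_eq_card_placements[OF \<open>L \<in> ?LR\<close> m] fin by (simp add: sum.If_cases Int_def)
  qed
  also have "\<dots> = (\<Sum>q\<in>?Q. \<Sum>L\<in>?LR. if ?P L q then 1 else 0)" by (rule sum.swap)
  also have "\<dots> = (\<Sum>q\<in>?Q. real (card {L \<in> ?LR. ?P L q}))"
    using fin by (simp add: sum.If_cases Int_def)
  finally have \<mu>: "\<mu> = (\<Sum>q\<in>?Q. real (card {L \<in> ?LR. ?P L q})) / real (card ?LR)" .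
  have each: "a * real (card ?LR) \<le> real (card {L \<in> ?LR. ?P L q}) \<and>
      real (card {L \<in> ?LR. ?P L q}) \<le> b * real (card ?LR)" if q: "q \<in> ?Q" for q
  proof -
    obtain R C S F where qe: "q = ((R, C, S), F)" by (metis surj_pair)
    have "{L \<in> ?LR. ?P L q} = completions k n (R \<times> C) F" by (auto simp: qe completions_def)
    then show ?thesis using step[of R C S F] q by (auto simp: qe placements_def patterns_def)
  qed
  have "real (card ?Q) * (a * real (card ?LR)) \<le> (\<Sum>q\<in>?Q. real (card {L \<in> ?LR. ?P L q}))"
    using each by (intro sum_bounded_below) auto
  then show "real (card ?Q) * a \<le> \<mu>" using T unfolding \<mu> by (simp add: field_simps)
  have "(\<Sum>q\<in>?Q. real (card {L \<in> ?LR. ?P L q})) \<le> real (card ?Q) * (b * real (card ?LR))"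
    using each by (intro sum_bounded_above) auto
  then show "\<mu> \<le> real (card ?Q) * b" using T unfolding \<mu> by (simp add: field_simps)
qed

section \<open>Choice of the constants\<close>

text \<open>
  The number \<open>l\<close> of rounds is chosen so that the excess of the crude ratio over 1, which is at
  most \<open>1 / \<alpha>\<close>, is damped by \<open>\<theta>\<^sup>l\<close> to \<open>\<eta> / 2\<close>; it does not depend on \<open>n\<close>. The degrees lie between \<open>n - k + 1 - m\<close> and
  \<open>n - k + 1\<close>, and the \<open>2 * l + 1\<close> lost in the process are negligible for large \<open>n\<close>. The relative
  irregularity is then of order \<open>m / n\<close>, so the bound on \<open>m\<close> makes its contribution at most \<open>\<eta> / 2\<close>.
\<close>

lemma uniform_rows_eventually:
  fixes \<alpha> \<eta> :: real
  assumes \<alpha>: "0 < \<alpha>" "\<alpha> \<le> 1" and \<eta>: "0 < \<eta>" "\<eta> \<le> 1"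
  shows "\<forall>\<^sub>F n in sequentially. \<forall>k m. real k < (1/2 - \<alpha>) * real n \<longrightarrow> real m \<le> \<eta> * \<alpha> / 16 * real n \<longrightarrow>
           uniform_rows (1 + \<eta>) n k m"
proof -
  define \<beta> where "\<beta> = \<eta> * \<alpha> / 16"
  define \<theta> where "\<theta> = 1 - \<alpha> / 2"
  have \<beta>: "0 < \<beta>" "\<beta> \<le> \<alpha> / 16"
    using \<alpha> \<eta> mult_right_mono[of \<eta> 1 \<alpha>] by (auto simp: \<beta>_def)
  have \<theta>: "0 < \<theta>" "\<theta> < 1" using \<alpha> by (auto simp: \<theta>_def)
  \<comment> \<open>The degrees are at least \<open>(1 + \<alpha>) * n / 2\<close> in every round, so the
    contraction factor is at most \<open>1 - \<alpha> / 2 = \<theta>\<close>.\<close>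
  have "(\<lambda>l. \<theta> ^ l) \<longlonglongrightarrow> 0" using \<theta> by (intro LIMSEQ_power_zero) auto
  then have "\<forall>\<^sub>F l in sequentially. \<theta> ^ l < \<alpha> * \<eta> / 2"
    using \<alpha> \<eta> by (intro order_tendstoD(2)) auto
  then obtain l where l: "\<theta> ^ l < \<alpha> * \<eta> / 2" by (auto simp: eventually_sequentially)
  have "\<forall>\<^sub>F n in sequentially. real (2 * l + 1) / \<beta> \<le> real n"
    using filterlim_real_sequentially by (simp only: filterlim_at_top)
  then show ?thesis
  proof eventually_elim
    case (elim n)
    then have nl: "2 * real l + 1 \<le> \<beta> * real n" using \<beta> by (simp add: field_simps)
    show ?case
    proof (intro allI impI)
      fix k m assume k: "real k < (1/2 - \<alpha>) * real n" and m: "real m \<le> \<eta> * \<alpha> / 16 * real n"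
      have m': "real m \<le> \<beta> * real n" using m by (simp add: \<beta>_def)
      define lo where "lo = n - k - m - 2 * l"
      define hi where "hi = n - k + 1"
      have n0: "0 < real n" using nl \<beta> by (cases "n = 0") auto
      have \<beta>n: "\<beta> * real n \<le> \<alpha> / 16 * real n" using \<beta> by (intro mult_right_mono) auto
      have \<alpha>n: "0 < \<alpha> * real n" "\<alpha> * real n \<le> real n" using \<alpha> n0 by auto
      have kr: "real k + \<alpha> * real n < real n / 2" using k by (simp add: algebra_simps)
      have "real k + real m + 2 * real l < real n" using kr nl m' \<beta>n \<alpha>n by linarith
      then have sum: "k + m + 2 * l < n" by linarith
      have rlo: "real lo = real n - real k - real m - 2 * real l"
        and rhi: "real hi = real n - real k + 1" using sum by (auto simp: lo_def hi_def of_nat_diff)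
      have eq: "hi - m = lo + 2 * l + 1" using sum by (simp add: lo_def hi_def)
      have lo_ge: "real n / 2 + \<alpha> * real n / 2 \<le> real lo" using rlo kr nl m' \<beta>n \<alpha>n by linarith
      have w: "real hi - real lo \<le> 2 * (\<beta> * real n)" using rlo rhi nl m' by linarith
      show "uniform_rows (1 + \<eta>) n k m"
        unfolding uniform_rows_def hi_def[symmetric]
      proof (intro allI impI)
        fix E and J S :: "nat set"
        assume nr: "near_regular E J S (hi - m) hi" and c: "card J = card S" "card S \<le> n"
        show "uniform_edges (1 + \<eta>) (hi - m) hi E J S"
        proof (rule uniform_edgesI[OF nr c eq, where \<theta> = \<theta> and \<omega> = "4 * \<beta>"])
          show "n < 2 * lo" using lo_ge \<alpha>n by linarith
          show "lo \<le> n" "lo \<le> hi" by (auto simp: lo_def hi_def)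
          show "\<theta> < 1" by (rule \<theta>)
          have "\<beta> * real n \<le> \<beta> * (2 * real lo)" using lo_ge \<alpha>n \<beta> by (intro mult_left_mono) auto
          then show "real hi - real lo \<le> 4 * \<beta> * real lo" using w by simp
          have "(2 - \<alpha> / 2) * (real n / 2 + \<alpha> * real n / 2) \<le> (2 - \<alpha> / 2) * real lo"
            using lo_ge \<alpha> by (intro mult_left_mono) auto
          moreover have "\<alpha> * (\<alpha> * real n) \<le> 1 * (\<alpha> * real n)" using \<alpha> \<alpha>n by (intro mult_right_mono) auto
          moreover have "(2 - \<alpha> / 2) * (real n / 2 + \<alpha> * real n / 2)
                = real n + 3/4 * (\<alpha> * real n) - \<alpha> * (\<alpha> * real n) / 4"
              "(2 - \<alpha> / 2) * real lo = real lo + \<theta> * real lo"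
            by (simp_all add: \<theta>_def algebra_simps)
          ultimately show "real n - real lo + (real hi - real lo) \<le> \<theta> * real lo"
            using w \<beta>n \<alpha>n by linarith
          have "\<theta> ^ l * (real n / (2 * real lo - real n)) \<le> \<theta> ^ l * (1 / \<alpha>)"
          proof (intro mult_left_mono)
            show "real n / (2 * real lo - real n) \<le> 1 / \<alpha>"
              using lo_ge \<alpha>n \<alpha> by (simp add: divide_simps) (simp add: algebra_simps)
          qed (use \<theta> in auto)
          also have "\<dots> \<le> \<eta> / 2" using l \<alpha> by (simp add: field_simps)
          finally have "\<theta> ^ l * (real n / (2 * real lo - real n)) \<le> \<eta> / 2" .
          moreover have "4 * \<beta> / (1 - \<theta>) = \<eta> / 2" using \<alpha> by (simp add: \<beta>_def \<theta>_def)
          ultimately show "1 + \<theta> ^ l * (real n / (2 * real lo - real n)) + 4 * \<beta> / (1 - \<theta>) \<le> 1 + \<eta>"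
            by linarith
        qed
      qed
    qed
  qed
qed

text \<open>
  The two factors of \<open>self_consistent_estimate\<close> are \<open>1 / n\<close> up to powers of \<open>\<rho>\<close> and of
  \<open>(lo - \<rho>) / hi\<close> and \<open>(n + 1 - m) / n\<close>, each within \<open>O(\<eta>)\<close> of 1.
\<close>

lemma step_constants:
  fixes \<alpha> \<eta> n k m :: real
  assumes \<alpha>: "0 < \<alpha>" "\<alpha> \<le> 1" and \<eta>: "0 < \<eta>" "\<eta> \<le> 1" and n: "0 < n" "2 \<le> \<eta> * \<alpha> / 16 * n"
    and k: "0 \<le> k" "k < (1/2 - \<alpha>) * n" and m: "0 \<le> m" "m \<le> \<eta> * \<alpha> / 16 * n"
  defines "\<rho> \<equiv> 1 + \<eta>" and "hi \<equiv> n - k + 1"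
  defines "lo \<equiv> hi - m"
  shows "\<rho> < lo" and "(1 - 8 * \<eta>) / n \<le> (lo - \<rho>) / (hi * \<rho>\<^sup>2 * n)"
    and "\<rho>\<^sup>2 * hi / ((lo - \<rho>) * (n + 1 - m)) \<le> (1 + 8 * \<eta>) / n"
proof -
  have "\<eta> * \<alpha> \<le> \<eta>" using \<eta> \<alpha> by simp
  then have \<beta>n: "\<eta> * \<alpha> / 16 * n \<le> \<eta> / 16 * n" using n by (intro mult_right_mono) auto
  have "0 < \<alpha> * n" using \<alpha> n by simp
  then have hi: "n / 2 < hi" using k by (simp add: hi_def algebra_simps)
  have \<eta>n: "\<eta> * n \<le> 2 * (\<eta> * hi)" using hi \<eta> mult_left_mono[of n "2 * hi" \<eta>] by simp
  have small: "m + \<rho> \<le> \<eta> / 4 * hi"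
    unfolding \<rho>_def using m(2) n(2) \<beta>n \<eta>n \<eta>(2) by linarith
  have sq: "\<rho>\<^sup>2 \<le> 1 + 3 * \<eta>" using \<eta> mult_left_mono[of \<eta> 1 \<eta>] by (simp add: \<rho>_def power2_eq_square algebra_simps)
  have hi0: "0 < hi" using hi n by simp
  have lo_ge: "(1 - \<eta> / 4) * hi \<le> lo - \<rho>" using small by (simp add: lo_def algebra_simps)
  have pos: "0 < (1 - \<eta> / 4) * hi" using \<eta> hi0 by simp
  show "\<rho> < lo" using lo_ge pos by linarith
  have \<rho>0: "0 < \<rho>" using \<eta> by (simp add: \<rho>_def)
  have "(1 - 8 * \<eta>) * \<rho>\<^sup>2 \<le> 1 - \<eta> / 4"
  proof (cases "1 - 8 * \<eta> \<le> 0")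
    case True
    then have "(1 - 8 * \<eta>) * \<rho>\<^sup>2 \<le> 0" by (intro mult_nonpos_nonneg) auto
    then show ?thesis using \<eta> by simp
  next
    case False
    then have "(1 - 8 * \<eta>) * \<rho>\<^sup>2 \<le> (1 - 8 * \<eta>) * (1 + 3 * \<eta>)" using sq by (intro mult_left_mono) auto
    also have "\<dots> = 1 - 5 * \<eta> - 24 * (\<eta> * \<eta>)" by (simp add: algebra_simps)
    also have "\<dots> \<le> 1 - \<eta> / 4" using \<eta>(1) zero_le_square[of \<eta>] by linarith
    finally show ?thesis .
  qed
  then have "(1 - 8 * \<eta>) * \<rho>\<^sup>2 * hi \<le> (1 - \<eta> / 4) * hi" using hi0 by (intro mult_right_mono) auto
  then have "(1 - 8 * \<eta>) * \<rho>\<^sup>2 * hi \<le> lo - \<rho>" using lo_ge by linarith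
  then have "1 - 8 * \<eta> \<le> (lo - \<rho>) / (hi * \<rho>\<^sup>2)"
    using hi0 \<rho>0 by (subst pos_le_divide_eq) (auto simp: mult_ac)
  then have "(1 - 8 * \<eta>) / n \<le> (lo - \<rho>) / (hi * \<rho>\<^sup>2) / n"
    using n by (intro divide_right_mono) auto
  then show "(1 - 8 * \<eta>) / n \<le> (lo - \<rho>) / (hi * \<rho>\<^sup>2 * n)" by simp
  have nm: "(1 - \<eta> / 4) * n \<le> n + 1 - m"
  proof -
    have "0 \<le> \<eta> * n" using \<eta> n by simp
    then have "m \<le> \<eta> * n / 4" using m(2) \<beta>n by linarith
    then show ?thesis by (simp add: algebra_simps)
  qed
  have nm0: "0 < (1 - \<eta> / 4) * n" using \<eta> n by simp
  have "1 + 3 * \<eta> \<le> (1 + 8 * \<eta>) * ((1 - \<eta> / 4) * (1 - \<eta> / 4))"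
  proof -
    have "\<eta> * \<eta> \<le> \<eta>" using \<eta> mult_left_mono[of \<eta> 1 \<eta>] by simp
    then have "1 + 3 * \<eta> \<le> (1 + 8 * \<eta>) * (1 - \<eta> / 2)" using \<eta> by (simp add: algebra_simps)
    also have "\<dots> \<le> (1 + 8 * \<eta>) * ((1 - \<eta> / 4) * (1 - \<eta> / 4))"
      using \<eta> by (intro mult_left_mono) (auto simp: algebra_simps)
    finally show ?thesis .
  qed
  then have "\<rho>\<^sup>2 \<le> (1 + 8 * \<eta>) * ((1 - \<eta> / 4) * (1 - \<eta> / 4))" using sq by linarith
  then have "\<rho>\<^sup>2 * (hi * n) \<le> (1 + 8 * \<eta>) * ((1 - \<eta> / 4) * (1 - \<eta> / 4)) * (hi * n)"
    using hi0 n by (intro mult_right_mono) auto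
  also have "\<dots> = (1 + 8 * \<eta>) * (((1 - \<eta> / 4) * hi) * ((1 - \<eta> / 4) * n))" by simp
  also have "\<dots> \<le> (1 + 8 * \<eta>) * ((lo - \<rho>) * (n + 1 - m))"
    using lo_ge nm pos nm0 \<eta> by (intro mult_left_mono mult_mono) auto
  finally have "\<rho>\<^sup>2 * hi * n \<le> (1 + 8 * \<eta>) * ((lo - \<rho>) * (n + 1 - m))" by simp
  moreover have "0 < (lo - \<rho>) * (n + 1 - m)" using lo_ge nm pos nm0 by (intro mult_pos_pos) linarith+
  ultimately show "\<rho>\<^sup>2 * hi / ((lo - \<rho>) * (n + 1 - m)) \<le> (1 + 8 * \<eta>) / n"
    using n by (simp add: divide_simps mult_ac)
qed

lemma expectation_SS_eventually:
  fixes \<alpha> \<epsilon> :: real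
  assumes \<alpha>: "0 < \<alpha>" "\<alpha> \<le> 1" and \<epsilon>: "0 < \<epsilon>" "\<epsilon> \<le> 1"
  shows "\<forall>\<^sub>F n in sequentially. \<forall>k m. real k < (1/2 - \<alpha>) * real n \<longrightarrow> 1 \<le> m \<longrightarrow>
      real m \<le> \<epsilon> * \<alpha> / 128 * real n \<longrightarrow>
      real (card (placements k n m)) * ((1 - \<epsilon>) / real n) ^ (m\<^sup>2)
        \<le> measure_pmf.expectation (pmf_of_set (latin_rectangles k n)) (\<lambda>L. real (SS k n m L)) \<and>
      measure_pmf.expectation (pmf_of_set (latin_rectangles k n)) (\<lambda>L. real (SS k n m L))
        \<le> real (card (placements k n m)) * ((1 + \<epsilon>) / real n) ^ (m\<^sup>2)"
proof -
  define \<eta> where "\<eta> = \<epsilon> / 8"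
  have \<eta>: "0 < \<eta>" "\<eta> \<le> 1" using \<epsilon> by (auto simp: \<eta>_def)
  have \<eta>8: "8 * \<eta> = \<epsilon>" and \<beta>: "\<epsilon> * \<alpha> / 128 = \<eta> * \<alpha> / 16" by (auto simp: \<eta>_def)
  have \<beta>0: "0 < \<eta> * \<alpha> / 16" using \<eta> \<alpha> by simp
  have "\<forall>\<^sub>F n in sequentially. 2 / (\<eta> * \<alpha> / 16) \<le> real n"
    using filterlim_real_sequentially by (simp only: filterlim_at_top)
  with uniform_rows_eventually[OF \<alpha> \<eta>] show ?thesis
  proof eventually_elim
    case (elim n)
    have n2: "2 \<le> \<eta> * \<alpha> / 16 * real n" using elim(2) \<beta>0 by (simp add: pos_divide_le_eq mult.commute)
    then have n0: "0 < real n" using \<beta>0 by (cases "n = 0") auto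
    show ?case
    proof (intro allI impI)
      fix k m
      assume k: "real k < (1/2 - \<alpha>) * real n" and m1: "1 \<le> m" and m: "real m \<le> \<epsilon> * \<alpha> / 128 * real n"
      have m': "real m \<le> \<eta> * \<alpha> / 16 * real n" using m unfolding \<beta> .
      have "(1/2 - \<alpha>) * real n \<le> 1 * real n" using \<alpha> by (intro mult_right_mono) auto
      then have kn: "k \<le> n" using k by linarith
      note const = step_constants[OF \<alpha> \<eta> n0 n2 of_nat_0_le_iff k of_nat_0_le_iff m', unfolded \<eta>8]
      have UR: "uniform_rows (1 + \<eta>) n k m" using elim(1) k m' by blast
      have step: "((1 - \<epsilon>) / real n) ^ (m\<^sup>2) * real (card (latin_rectangles k n))
            \<le> real (card (completions k n (R \<times> C) F)) \<and>
          real (card (completions k n (R \<times> C) F))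
            \<le> ((1 + \<epsilon>) / real n) ^ (m\<^sup>2) * real (card (latin_rectangles k n))"
        if RCS: "R \<subseteq> {1..k}" "card R = m" "C \<subseteq> {1..n}" "card C = m" "S \<subseteq> {1..n}"
          and F: "latin_square_on R C S F" for R C S F
      proof -
        have cell: "(1 - \<epsilon>) / real n * real (card (completions k n D F))
              \<le> real (card (completions k n (insert (i, j) D) F)) \<and>
            real (card (completions k n (insert (i, j) D) F))
              \<le> (1 + \<epsilon>) / real n * real (card (completions k n D F))"
          if D: "D \<subseteq> R \<times> C" "(i, j) \<in> R \<times> C - D" for D i j
        proof -
          have "1 \<le> 1 + \<eta>" using \<eta> by simp
          note ins = card_completions_insert[OF kn RCS F D UR this const(1)]
          show ?thesis
            using order_trans[OF mult_right_mono[OF const(2)] ins(1)]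
              order_trans[OF ins(2) mult_right_mono[OF const(3)]] by simp
        qed
        show ?thesis
          using card_completions_pattern[OF kn RCS F cell] \<epsilon> n0 by simp
      qed
      show "real (card (placements k n m)) * ((1 - \<epsilon>) / real n) ^ (m\<^sup>2)
          \<le> measure_pmf.expectation (pmf_of_set (latin_rectangles k n)) (\<lambda>L. real (SS k n m L)) \<and>
        measure_pmf.expectation (pmf_of_set (latin_rectangles k n)) (\<lambda>L. real (SS k n m L))
          \<le> real (card (placements k n m)) * ((1 + \<epsilon>) / real n) ^ (m\<^sup>2)"
      proof
        show "real (card (placements k n m)) * ((1 - \<epsilon>) / real n) ^ (m\<^sup>2)
          \<le> measure_pmf.expectation (pmf_of_set (latin_rectangles k n)) (\<lambda>L. real (SS k n m L))"
          by (rule expectation_SS_bounds(1)[OF kn m1]) (rule step; assumption)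
        show "measure_pmf.expectation (pmf_of_set (latin_rectangles k n)) (\<lambda>L. real (SS k n m L))
          \<le> real (card (placements k n m)) * ((1 + \<epsilon>) / real n) ^ (m\<^sup>2)"
          by (rule expectation_SS_bounds(2)[OF kn m1]) (rule step; assumption)
      qed
    qed
  qed
qed

(* The guard on the lower bound excludes only values of epsilon for which (1 - epsilon)^(m^2) is
   at least 1 for even m: taken literally, the lower bound fails for epsilon > 2 (e.g. k = m = 2),
   whereas the bound is meant to lose a factor. *)
theorem corollary1p7:
  fixes \<epsilon> \<alpha> :: real
  assumes "\<epsilon> > 0" and "\<alpha> > 0"
  shows "\<exists>\<beta>>0::real. \<forall>\<^sub>F n in sequentially. \<forall>k\<ge>1. real k < (1/2 - \<alpha>) * real n \<longrightarrow>
    (\<forall>m\<ge>1. real m \<le> \<beta> * real n \<longrightarrow>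
      (\<epsilon> < 2 \<longrightarrow>
        real (n choose m) ^ 2 * real (k choose m) * real (card (latin_squares m))
            * ((1 - \<epsilon>) / real n) ^ (m ^ 2)
          \<le> measure_pmf.expectation (pmf_of_set (latin_rectangles k n)) (\<lambda>L. real (SS k n m L))) \<and>
      measure_pmf.expectation (pmf_of_set (latin_rectangles k n)) (\<lambda>L. real (SS k n m L))
        \<le> real (n choose m) ^ 2 * real (k choose m) * real (card (latin_squares m))
            * ((1 + \<epsilon>) / real n) ^ (m ^ 2))"
proof -
  define \<alpha>' where "\<alpha>' = min \<alpha> 1"
  \<comment> \<open>As \<open>1 - \<epsilon>\<close> may be negative, the lower bound needs its absolute value to be
    at most \<open>1 - \<epsilon>'\<close>, which is why the distance of \<open>\<epsilon>\<close> to 2 enters.\<close>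
  define \<epsilon>' where "\<epsilon>' = (if \<epsilon> < 2 then min (1/2) (min \<epsilon> (2 - \<epsilon>)) else 1/2)"
  have \<alpha>': "0 < \<alpha>'" "\<alpha>' \<le> 1" "\<alpha>' \<le> \<alpha>" using assms by (auto simp: \<alpha>'_def)
  have \<epsilon>': "0 < \<epsilon>'" "\<epsilon>' \<le> 1" "\<epsilon>' \<le> \<epsilon>" "\<epsilon> < 2 \<Longrightarrow> \<bar>1 - \<epsilon>\<bar> \<le> 1 - \<epsilon>'"
    using assms by (auto simp: \<epsilon>'_def)
  show ?thesis
  proof (intro exI conjI)
    show "0 < \<epsilon>' * \<alpha>' / 128" using \<alpha>' \<epsilon>' by simp
    show "\<forall>\<^sub>F n in sequentially. \<forall>k\<ge>1. real k < (1/2 - \<alpha>) * real n \<longrightarrow>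
      (\<forall>m\<ge>1. real m \<le> \<epsilon>' * \<alpha>' / 128 * real n \<longrightarrow>
        (\<epsilon> < 2 \<longrightarrow>
          real (n choose m) ^ 2 * real (k choose m) * real (card (latin_squares m))
              * ((1 - \<epsilon>) / real n) ^ (m ^ 2)
            \<le> measure_pmf.expectation (pmf_of_set (latin_rectangles k n)) (\<lambda>L. real (SS k n m L))) \<and>
        measure_pmf.expectation (pmf_of_set (latin_rectangles k n)) (\<lambda>L. real (SS k n m L))
          \<le> real (n choose m) ^ 2 * real (k choose m) * real (card (latin_squares m))
              * ((1 + \<epsilon>) / real n) ^ (m ^ 2))"
      using expectation_SS_eventually[OF \<alpha>'(1,2) \<epsilon>'(1,2)]
    proof eventually_elim
      case (elim n)
      show ?case
      proof (intro allI impI)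
        fix k m :: nat
        assume k: "real k < (1/2 - \<alpha>) * real n" and m: "1 \<le> m" "real m \<le> \<epsilon>' * \<alpha>' / 128 * real n"
        let ?\<mu> = "measure_pmf.expectation (pmf_of_set (latin_rectangles k n)) (\<lambda>L. real (SS k n m L))"
        let ?P = "real (n choose m) ^ 2 * real (k choose m) * real (card (latin_squares m))"
        have P: "real (card (placements k n m)) = ?P" by (simp add: card_placements)
        have "(1/2 - \<alpha>) * real n \<le> (1/2 - \<alpha>') * real n" using \<alpha>' by (intro mult_right_mono) auto
        then have k': "real k < (1/2 - \<alpha>') * real n" using k by linarith
        have bounds: "?P * ((1 - \<epsilon>') / real n) ^ (m\<^sup>2) \<le> ?\<mu>" "?\<mu> \<le> ?P * ((1 + \<epsilon>') / real n) ^ (m\<^sup>2)"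
          using elim[rule_format, OF k' m, unfolded P] by (rule conjunct1, rule conjunct2)
        have "?P * ((1 - \<epsilon>) / real n) ^ (m\<^sup>2) \<le> ?P * ((1 - \<epsilon>') / real n) ^ (m\<^sup>2)" if "\<epsilon> < 2"
        proof (rule mult_left_mono)
          have "((1 - \<epsilon>) / real n) ^ (m\<^sup>2) \<le> \<bar>(1 - \<epsilon>) / real n\<bar> ^ (m\<^sup>2)"
            by (metis abs_ge_self power_abs)
          also have "\<dots> \<le> ((1 - \<epsilon>') / real n) ^ (m\<^sup>2)"
            using \<epsilon>'(4)[OF that] by (intro power_mono) (auto simp: abs_divide intro: divide_right_mono)
          finally show "((1 - \<epsilon>) / real n) ^ (m\<^sup>2) \<le> ((1 - \<epsilon>') / real n) ^ (m\<^sup>2)" .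
        qed simp
        moreover have "?P * ((1 + \<epsilon>') / real n) ^ (m\<^sup>2) \<le> ?P * ((1 + \<epsilon>) / real n) ^ (m\<^sup>2)"
          using \<epsilon>' by (intro mult_left_mono power_mono divide_right_mono) auto
        ultimately show "(\<epsilon> < 2 \<longrightarrow> ?P * ((1 - \<epsilon>) / real n) ^ (m\<^sup>2) \<le> ?\<mu>) \<and>
            ?\<mu> \<le> ?P * ((1 + \<epsilon>) / real n) ^ (m\<^sup>2)"
          using bounds by linarith
      qed
    qed
  qed
qed

end
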